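(* Let $\mathbb{k}=\mathbb{F}_q$, let $Q$ be the quiver $1\longrightarrow 2\longrightarrow 3$ (three vertices, one arrow $1\to 2$ and one arrow $2\to 3$), and let $\mathbf{d}=(l,d,m)$ with integers $l,d,m\geq 1$. Then $$[Q,\mathbf{d}]=q^{2lm}\sum_{i=\max\{0,2d-l\}}^{2d}\left(q^{mi}\prod_{j=0}^{i-1}\left(\frac{q^{2d}-q^j}{q^i-q^j}\right)\prod_{j=0}^{2d-i-1}\left(q^l-q^j\right)\right),$$ where empty products are equal to $1$.
   Context: Let $\mathbb{k}=\mathbb{F}_q$ be a finite field. For an acyclic quiver $Q$ with vertex set $Q_0$ and a vertex $i$, $P_Q(i)$ is the indecomposable projective representation of $Q$ over $\mathbb{k}$ at $i$: its space at vertex $j$ has as basis the set of all paths from $i$ to $j$ (including the constant path $e_i$ if $j=i$), and an arrow $\alpha:j\to k$ acts by $c\mapsto c\alpha$ (paths are written left to right). For a summand vector $\mathbf{d}\in\mathbb{Z}_{\geq 0}^{Q_0}$, $P_{Q,\mathbf{d}}:=\bigoplus_{i\in Q_0}P_Q(i)^{d_i}$ and $A_{Q,\mathbf{d}}:=\operatorname{End}(P_{Q,\mathbf{d}})$ is its endomorphism algebra in the category of representations of $Q$ over $\mathbb{k}$. $\operatorname{rad}$ denotes the Jacobson radical. The count $[Q,\mathbf{d}]$ is the number of pairs $(x,y)\in\operatorname{rad}A_{Q,\mathbf{d}}\times\operatorname{rad}A_{Q,\mathbf{d}}$ with $xy=yx$. *)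

theory Defs
  imports Complex_Main "HOL-Library.Cardinality" "HOL-Library.Function_Algebras" "HOL-Algebra.Ring" "Graph_Theory.Arc_Walk"
begin

section \<open>Quiver representations\<close>

text \<open>
  A quiver is a directed multigraph, and a path from \<open>i\<close> to \<open>j\<close> is an arc walk, i.e. the list of its
  arrows from left to right. The scalars form a field in the sense of the type classes. The space of
  a representation at a vertex is a subset of a common abelian group \<open>'m\<close>; only its behaviour on
  these subsets matters.
\<close>

record ('v, 'e, 'k, 'm) quiver_rep =
  rep_space :: "'v \<Rightarrow> 'm set"
  rep_scale :: "'k \<Rightarrow> 'm \<Rightarrow> 'm"
  rep_map :: "'e \<Rightarrow> 'm \<Rightarrow> 'm"

locale quiver_representation = wf_digraph Q
  for Q :: "('v, 'e) pre_digraph" (structure)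
    and M :: "('v, 'e, 'k::field, 'm::ab_group_add) quiver_rep" +
  assumes zero_closed: "v \<in> verts Q \<Longrightarrow> 0 \<in> rep_space M v"
    and add_closed: "\<lbrakk>v \<in> verts Q; x \<in> rep_space M v; y \<in> rep_space M v\<rbrakk> \<Longrightarrow> x + y \<in> rep_space M v"
    and scale_closed: "\<lbrakk>v \<in> verts Q; x \<in> rep_space M v\<rbrakk> \<Longrightarrow> rep_scale M c x \<in> rep_space M v"
    and scale_add_right: "\<lbrakk>v \<in> verts Q; x \<in> rep_space M v; y \<in> rep_space M v\<rbrakk>
          \<Longrightarrow> rep_scale M c (x + y) = rep_scale M c x + rep_scale M c y"
    and scale_add_left: "\<lbrakk>v \<in> verts Q; x \<in> rep_space M v\<rbrakk>
          \<Longrightarrow> rep_scale M (c + c') x = rep_scale M c x + rep_scale M c' x"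
    and scale_scale: "\<lbrakk>v \<in> verts Q; x \<in> rep_space M v\<rbrakk>
          \<Longrightarrow> rep_scale M c (rep_scale M c' x) = rep_scale M (c * c') x"
    and scale_one: "\<lbrakk>v \<in> verts Q; x \<in> rep_space M v\<rbrakk> \<Longrightarrow> rep_scale M 1 x = x"
    and map_closed: "\<lbrakk>a \<in> arcs Q; x \<in> rep_space M (tail Q a)\<rbrakk> \<Longrightarrow> rep_map M a x \<in> rep_space M (head Q a)"
    and map_add: "\<lbrakk>a \<in> arcs Q; x \<in> rep_space M (tail Q a); y \<in> rep_space M (tail Q a)\<rbrakk>
          \<Longrightarrow> rep_map M a (x + y) = rep_map M a x + rep_map M a y"
    and map_scale: "\<lbrakk>a \<in> arcs Q; x \<in> rep_space M (tail Q a)\<rbrakk>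
          \<Longrightarrow> rep_map M a (rep_scale M c x) = rep_scale M c (rep_map M a x)"

text \<open>
  Morphisms are families of linear maps, made extensional both in the vertex and in the argument so
  that distinct elements are distinct morphisms.
\<close>

definition rep_hom ::
  "('v, 'e) pre_digraph \<Rightarrow> ('v, 'e, 'k, 'm::ab_group_add) quiver_rep
    \<Rightarrow> ('v, 'e, 'k, 'n::ab_group_add) quiver_rep \<Rightarrow> ('v \<Rightarrow> 'm \<Rightarrow> 'n) set" where
  "rep_hom Q M N =
    {\<phi> \<in> (\<Pi>\<^sub>E v\<in>verts Q. rep_space M v \<rightarrow>\<^sub>E rep_space N v).
      (\<forall>v\<in>verts Q. \<forall>x\<in>rep_space M v. \<forall>y\<in>rep_space M v. \<phi> v (x + y) = \<phi> v x + \<phi> v y) \<and>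
      (\<forall>v\<in>verts Q. \<forall>c. \<forall>x\<in>rep_space M v. \<phi> v (rep_scale M c x) = rep_scale N c (\<phi> v x)) \<and>
      (\<forall>a\<in>arcs Q. \<forall>x\<in>rep_space M (tail Q a).
         \<phi> (head Q a) (rep_map M a x) = rep_map N a (\<phi> (tail Q a) x))}"

definition rep_end ::
  "('v, 'e) pre_digraph \<Rightarrow> ('v, 'e, 'k, 'm::ab_group_add) quiver_rep \<Rightarrow> ('v \<Rightarrow> 'm \<Rightarrow> 'm) ring" where
  "rep_end Q M =
    \<lparr>carrier = rep_hom Q M M,
     mult = (\<lambda>\<phi> \<psi>. \<lambda>v\<in>verts Q. compose (rep_space M v) (\<phi> v) (\<psi> v)),
     one = (\<lambda>v\<in>verts Q. \<lambda>x\<in>rep_space M v. x),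
     zero = (\<lambda>v\<in>verts Q. \<lambda>x\<in>rep_space M v. 0),
     add = (\<lambda>\<phi> \<psi>. \<lambda>v\<in>verts Q. \<lambda>x\<in>rep_space M v. \<phi> v x + \<psi> v x)\<rparr>"

definition direct_sum_rep ::
  "'i set \<Rightarrow> ('i \<Rightarrow> ('v, 'e, 'k, 'm::zero) quiver_rep) \<Rightarrow> ('v, 'e, 'k, 'i \<Rightarrow> 'm) quiver_rep" where
  "direct_sum_rep I M =
    \<lparr>rep_space = (\<lambda>v. {x. finite {i. x i \<noteq> 0} \<and> (\<forall>i\<in>I. x i \<in> rep_space (M i) v) \<and> (\<forall>i. i \<notin> I \<longrightarrow> x i = 0)}),
     rep_scale = (\<lambda>c x i. if i \<in> I then rep_scale (M i) c (x i) else 0),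
     rep_map = (\<lambda>a x i. if i \<in> I then rep_map (M i) a (x i) else 0)\<rparr>"

text \<open>
  The space of the indecomposable projective at \<open>i\<close> is spanned by paths; its elements are given by
  their coefficient functions. The arrow \<open>a\<close> sends a path \<open>p\<close> to \<open>p @ [a]\<close>, so the coefficient of
  \<open>p @ [a]\<close> in the image is that of \<open>p\<close>, and paths not ending in \<open>a\<close> get coefficient \<open>0\<close>.
\<close>

definition projective_rep ::
  "('v, 'e) pre_digraph \<Rightarrow> 'v \<Rightarrow> ('v, 'e, 'k::field, 'e list \<Rightarrow> 'k) quiver_rep" where
  "projective_rep Q i =
    \<lparr>rep_space = (\<lambda>j. {f. finite {p. f p \<noteq> 0} \<and> {p. f p \<noteq> 0} \<subseteq> {p. pre_digraph.awalk Q i p j}}),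
     rep_scale = (\<lambda>c f p. c * f p),
     rep_map = (\<lambda>a f p. if p \<noteq> [] \<and> last p = a then f (butlast p) else 0)\<rparr>"

text \<open>The index \<open>(i, r)\<close> with \<open>r < d i\<close> is the \<open>r\<close>-th copy of the projective at \<open>i\<close>.\<close>

definition projective_sum_rep ::
  "('v, 'e) pre_digraph \<Rightarrow> ('v \<Rightarrow> nat) \<Rightarrow> ('v, 'e, 'k::field, 'v \<times> nat \<Rightarrow> 'e list \<Rightarrow> 'k) quiver_rep" where
  "projective_sum_rep Q d =
    direct_sum_rep (SIGMA i:verts Q. {..<d i}) (\<lambda>(i, r). projective_rep Q i)"

section \<open>Jacobson radical and commuting pairs\<close>

definition left_ideal :: "'a set \<Rightarrow> ('a, 'b) ring_scheme \<Rightarrow> bool" where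
  "left_ideal I R \<longleftrightarrow> subgroup I (add_monoid R) \<and> (\<forall>a\<in>carrier R. \<forall>x\<in>I. a \<otimes>\<^bsub>R\<^esub> x \<in> I)"

definition maximal_left_ideal :: "'a set \<Rightarrow> ('a, 'b) ring_scheme \<Rightarrow> bool" where
  "maximal_left_ideal I R \<longleftrightarrow>
    left_ideal I R \<and> I \<noteq> carrier R \<and>
    (\<forall>J. left_ideal J R \<and> I \<subseteq> J \<longrightarrow> J = I \<or> J = carrier R)"

definition jacobson_radical :: "('a, 'b) ring_scheme \<Rightarrow> 'a set" where
  "jacobson_radical R = {x \<in> carrier R. \<forall>I. maximal_left_ideal I R \<longrightarrow> x \<in> I}"

definition commuting_radical_pairs ::
  "'k::field itself \<Rightarrow> ('v, 'e) pre_digraph \<Rightarrow> ('v \<Rightarrow> nat) \<Rightarrow> nat" where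
  "commuting_radical_pairs K Q d =
    (let A = rep_end Q (projective_sum_rep Q d :: ('v, 'e, 'k, 'v \<times> nat \<Rightarrow> 'e list \<Rightarrow> 'k) quiver_rep)
     in card {(x, y). x \<in> jacobson_radical A \<and> y \<in> jacobson_radical A \<and> x \<otimes>\<^bsub>A\<^esub> y = y \<otimes>\<^bsub>A\<^esub> x})"

definition linear_quiver_3 :: "(nat, nat \<times> nat) pre_digraph" where
  "linear_quiver_3 = \<lparr>verts = {1, 2, 3}, arcs = {(1, 2), (2, 3)}, tail = fst, head = snd\<rparr>"

section \<open>Well-formedness\<close>

context quiver_representation
begin

lemma scale_zero_left: "\<lbrakk>v \<in> verts Q; x \<in> rep_space M v\<rbrakk> \<Longrightarrow> rep_scale M 0 x = 0"
  using scale_add_left[of v x 0 0] by simp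

lemma scale_zero_right: "v \<in> verts Q \<Longrightarrow> rep_scale M c 0 = 0"
  using scale_add_right[of v 0 0 c] zero_closed[of v] by simp

lemma map_zero: "a \<in> arcs Q \<Longrightarrow> rep_map M a 0 = 0"
  using map_add[of a 0 0] zero_closed[of "tail Q a"] by simp

lemma uminus_eq_scale: "\<lbrakk>v \<in> verts Q; x \<in> rep_space M v\<rbrakk> \<Longrightarrow> - x = rep_scale M (- 1) x"
  using scale_add_left[of v x 1 "- 1"] scale_zero_left[of v x] scale_one[of v x]
  by (simp add: minus_unique)

end

lemma quiver_representation_projective_rep:
  assumes "wf_digraph Q"
  shows "quiver_representation Q (projective_rep Q i :: ('v, 'e, 'k::field, _) quiver_rep)"
proof -
  interpret wf_digraph Q by fact
  have fin: "finite {p. f p + g p \<noteq> 0}" if "finite {p. f p \<noteq> 0}" "finite {p. g p \<noteq> 0}"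
    for f g :: "'e list \<Rightarrow> 'k"
    by (rule finite_subset[OF _ finite_UnI[OF that]]) auto
  have walk: "awalk i (p @ [a]) (head Q a)" if "awalk i p (tail Q a)" "a \<in> arcs Q" for p a
    using that by (intro awalk_appendI[OF that(1)]) (auto simp: awalk_def)
  have img: "{p. p \<noteq> [] \<and> last p = a \<and> f (butlast p) \<noteq> 0} = (\<lambda>p. p @ [a]) ` {p. f p \<noteq> 0}"
    for a and f :: "'e list \<Rightarrow> 'k"
    by (auto simp: image_iff) (metis append_butlast_last_id)
  show ?thesis
  proof unfold_locales
    fix a and x :: "'e list \<Rightarrow> 'k"
    assume a: "a \<in> arcs Q"
      and x: "x \<in> rep_space (projective_rep Q i :: ('v, 'e, 'k, _) quiver_rep) (tail Q a)"
    have "{p. (if p \<noteq> [] \<and> last p = a then x (butlast p) else 0) \<noteq> 0} = (\<lambda>p. p @ [a]) ` {p. x p \<noteq> 0}"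
      by (subst img[symmetric]) auto
    with a x walk show "rep_map (projective_rep Q i) a x
        \<in> rep_space (projective_rep Q i :: ('v, 'e, 'k, _) quiver_rep) (head Q a)"
      by (auto simp: projective_rep_def)
  next
    fix v and x y :: "'e list \<Rightarrow> 'k"
    let ?P = "projective_rep Q i :: ('v, 'e, 'k, _) quiver_rep"
    assume "x \<in> rep_space ?P v" "y \<in> rep_space ?P v"
    then show "x + y \<in> rep_space ?P v"
      using fin[of x y] by (auto simp: projective_rep_def subset_iff) (metis add_0)
  next
    fix v and x :: "'e list \<Rightarrow> 'k" and c
    let ?P = "projective_rep Q i :: ('v, 'e, 'k, _) quiver_rep"
    assume "x \<in> rep_space ?P v"
    then show "rep_scale ?P c x \<in> rep_space ?P v"
      by (auto simp: projective_rep_def subset_iff)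
  qed (auto simp: projective_rep_def distrib_left distrib_right mult.assoc fun_eq_iff)
qed

lemma quiver_representation_direct_sum_rep:
  fixes M :: "'i \<Rightarrow> ('v, 'e, 'k::field, 'm::ab_group_add) quiver_rep"
  assumes "wf_digraph Q" and M: "\<And>i. i \<in> I \<Longrightarrow> quiver_representation Q (M i)"
  shows "quiver_representation Q (direct_sum_rep I M)"
proof -
  interpret wf_digraph Q by fact
  note R = quiver_representation.zero_closed[OF M] quiver_representation.add_closed[OF M]
    quiver_representation.scale_closed[OF M] quiver_representation.scale_add_right[OF M]
    quiver_representation.scale_add_left[OF M] quiver_representation.scale_scale[OF M]
    quiver_representation.scale_one[OF M] quiver_representation.map_closed[OF M]
    quiver_representation.map_add[OF M] quiver_representation.map_scale[OF M]
  have fin: "finite {i. f i + g i \<noteq> 0}" if "finite {i. f i \<noteq> 0}" "finite {i. g i \<noteq> 0}"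
    for f g :: "'i \<Rightarrow> 'm"
    by (rule finite_subset[OF _ finite_UnI[OF that]]) auto
  show ?thesis
  proof unfold_locales
    fix v and x :: "'i \<Rightarrow> 'm" and c
    assume v: "v \<in> verts Q" and x: "x \<in> rep_space (direct_sum_rep I M) v"
    have "finite {i. (if i \<in> I then rep_scale (M i) c (x i) else 0) \<noteq> 0}"
    proof (rule finite_subset)
      show "{i. (if i \<in> I then rep_scale (M i) c (x i) else 0) \<noteq> 0} \<subseteq> {i. x i \<noteq> 0}"
        using quiver_representation.scale_zero_right[OF M v] by (auto split: if_splits)
      show "finite {i. x i \<noteq> 0}"
        using x by (simp add: direct_sum_rep_def)
    qed
    then show "rep_scale (direct_sum_rep I M) c x \<in> rep_space (direct_sum_rep I M) v"
      using v x by (auto simp: direct_sum_rep_def R(3))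
  next
    fix a and x :: "'i \<Rightarrow> 'm"
    assume a: "a \<in> arcs Q" and x: "x \<in> rep_space (direct_sum_rep I M) (tail Q a)"
    have "finite {i. (if i \<in> I then rep_map (M i) a (x i) else 0) \<noteq> 0}"
    proof (rule finite_subset)
      show "{i. (if i \<in> I then rep_map (M i) a (x i) else 0) \<noteq> 0} \<subseteq> {i. x i \<noteq> 0}"
        using quiver_representation.map_zero[OF M a] by (auto split: if_splits)
      show "finite {i. x i \<noteq> 0}"
        using x by (simp add: direct_sum_rep_def)
    qed
    then show "rep_map (direct_sum_rep I M) a x \<in> rep_space (direct_sum_rep I M) (head Q a)"
      using a x by (auto simp: direct_sum_rep_def R(8))
  qed (auto simp: direct_sum_rep_def fun_eq_iff fin R)
qed

lemma quiver_representation_projective_sum_rep: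
  "wf_digraph Q \<Longrightarrow>
    quiver_representation Q (projective_sum_rep Q d :: ('v, 'e, 'k::field, _) quiver_rep)"
  unfolding projective_sum_rep_def
  by (rule quiver_representation_direct_sum_rep) (auto intro: quiver_representation_projective_rep)

lemma (in quiver_representation) ring_rep_end: "ring (rep_end Q M)"
proof -
  let ?R = "rep_end Q M"
  note D = rep_end_def rep_hom_def
  have hom: "\<phi> v x \<in> rep_space M v" "\<phi> v (x + y) = \<phi> v x + \<phi> v y"
      "\<phi> v (rep_scale M c x) = rep_scale M c (\<phi> v x)"
    if "\<phi> \<in> rep_hom Q M M" "v \<in> verts Q" "x \<in> rep_space M v" "y \<in> rep_space M v" for \<phi> v x y c
    using that by (auto simp: rep_hom_def PiE_iff)
  have hom_map: "\<phi> (head Q a) (rep_map M a x) = rep_map M a (\<phi> (tail Q a) x)"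
    if "\<phi> \<in> rep_hom Q M M" "a \<in> arcs Q" "x \<in> rep_space M (tail Q a)" for \<phi> a x
    using that by (auto simp: rep_hom_def)
  have eqI: "\<phi> = \<psi>" if "\<phi> \<in> rep_hom Q M M" "\<psi> \<in> rep_hom Q M M"
      "\<And>v x. \<lbrakk>v \<in> verts Q; x \<in> rep_space M v\<rbrakk> \<Longrightarrow> \<phi> v x = \<psi> v x" for \<phi> \<psi>
  proof (rule PiE_ext)
    show "\<phi> \<in> (\<Pi>\<^sub>E v\<in>verts Q. rep_space M v \<rightarrow>\<^sub>E rep_space M v)"
      "\<psi> \<in> (\<Pi>\<^sub>E v\<in>verts Q. rep_space M v \<rightarrow>\<^sub>E rep_space M v)"
      using that by (auto simp: rep_hom_def)
    then show "\<phi> v = \<psi> v" if "v \<in> verts Q" for v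
      using that \<open>\<And>v x. \<lbrakk>v \<in> verts Q; x \<in> rep_space M v\<rbrakk> \<Longrightarrow> \<phi> v x = \<psi> v x\<close>
      by (intro PiE_ext[of "\<phi> v" "rep_space M v" "\<lambda>_. rep_space M v"]) (auto simp: PiE_iff)
  qed
  have one: "\<one>\<^bsub>?R\<^esub> \<in> rep_hom Q M M"
    by (auto simp: D add_closed scale_closed map_closed)
  have zero: "\<zero>\<^bsub>?R\<^esub> \<in> rep_hom Q M M"
    by (auto simp: D add_closed scale_closed map_closed zero_closed scale_zero_right map_zero)
  have mult: "\<phi> \<otimes>\<^bsub>?R\<^esub> \<psi> \<in> rep_hom Q M M" if "\<phi> \<in> rep_hom Q M M" "\<psi> \<in> rep_hom Q M M" for \<phi> \<psi>
    using hom[OF that(1)] hom[OF that(2)] hom_map[OF that(1)] hom_map[OF that(2)]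
    by (auto simp: D compose_def add_closed scale_closed map_closed)
  have add: "\<phi> \<oplus>\<^bsub>?R\<^esub> \<psi> \<in> rep_hom Q M M" if "\<phi> \<in> rep_hom Q M M" "\<psi> \<in> rep_hom Q M M" for \<phi> \<psi>
    using hom[OF that(1)] hom[OF that(2)] hom_map[OF that(1)] hom_map[OF that(2)]
    by (auto simp: D add_closed scale_closed map_closed map_add scale_add_right)
  let ?n = "\<lambda>\<phi>. \<lambda>v\<in>verts Q. \<lambda>x\<in>rep_space M v. rep_scale M (- 1) (\<phi> v x)"
  have neg: "?n \<phi> \<in> rep_hom Q M M" if "\<phi> \<in> rep_hom Q M M" for \<phi>
    using hom[OF that] hom_map[OF that]
    by (auto simp: rep_hom_def add_closed scale_closed map_closed map_scale scale_add_right scale_scale)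
  have val: "(\<phi> \<oplus>\<^bsub>?R\<^esub> \<psi>) v x = \<phi> v x + \<psi> v x" "(\<phi> \<otimes>\<^bsub>?R\<^esub> \<psi>) v x = \<phi> v (\<psi> v x)"
      "\<one>\<^bsub>?R\<^esub> v x = x" "\<zero>\<^bsub>?R\<^esub> v x = 0"
    if "v \<in> verts Q" "x \<in> rep_space M v" for \<phi> \<psi> v x
    using that by (auto simp: rep_end_def compose_def)
  have car: "carrier ?R = rep_hom Q M M"
    by (simp add: rep_end_def)
  have neg_add: "?n \<phi> \<oplus>\<^bsub>?R\<^esub> \<phi> = \<zero>\<^bsub>?R\<^esub>" if "\<phi> \<in> rep_hom Q M M" for \<phi>
    using hom[OF that] that
    by (intro eqI add neg zero) (auto simp: val uminus_eq_scale[symmetric])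
  have closed: "\<phi> v x \<in> rep_space M v"
    if "\<phi> \<in> rep_hom Q M M" "v \<in> verts Q" "x \<in> rep_space M v" for \<phi> v x
    using hom(1)[OF that that(3)] .
  show ?thesis
  proof (intro ringI abelian_groupI monoidI, unfold car)
    fix \<phi> assume \<phi>: "\<phi> \<in> rep_hom Q M M"
    show "\<exists>\<psi>\<in>rep_hom Q M M. \<psi> \<oplus>\<^bsub>?R\<^esub> \<phi> = \<zero>\<^bsub>?R\<^esub>"
      using neg[OF \<phi>] neg_add[OF \<phi>] by blast
    show "\<zero>\<^bsub>?R\<^esub> \<oplus>\<^bsub>?R\<^esub> \<phi> = \<phi>"
      using \<phi> by (intro eqI add zero) (simp_all add: val)
    show "\<one>\<^bsub>?R\<^esub> \<otimes>\<^bsub>?R\<^esub> \<phi> = \<phi>" "\<phi> \<otimes>\<^bsub>?R\<^esub> \<one>\<^bsub>?R\<^esub> = \<phi>"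
      using \<phi> by (auto intro!: eqI mult one simp: val closed)
    fix \<psi> assume \<psi>: "\<psi> \<in> rep_hom Q M M"
    show "\<phi> \<oplus>\<^bsub>?R\<^esub> \<psi> = \<psi> \<oplus>\<^bsub>?R\<^esub> \<phi>"
      using \<phi> \<psi> by (intro eqI add) (simp_all add: val add.commute)
    fix \<theta> assume \<theta>: "\<theta> \<in> rep_hom Q M M"
    show "\<phi> \<oplus>\<^bsub>?R\<^esub> \<psi> \<oplus>\<^bsub>?R\<^esub> \<theta> = \<phi> \<oplus>\<^bsub>?R\<^esub> (\<psi> \<oplus>\<^bsub>?R\<^esub> \<theta>)"
      using \<phi> \<psi> \<theta> by (intro eqI add) (simp_all add: val add.assoc)
    show "\<phi> \<otimes>\<^bsub>?R\<^esub> \<psi> \<otimes>\<^bsub>?R\<^esub> \<theta> = \<phi> \<otimes>\<^bsub>?R\<^esub> (\<psi> \<otimes>\<^bsub>?R\<^esub> \<theta>)"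
      using \<phi> \<psi> \<theta> by (intro eqI mult) (simp_all add: val closed)
    show "(\<phi> \<oplus>\<^bsub>?R\<^esub> \<psi>) \<otimes>\<^bsub>?R\<^esub> \<theta> = \<phi> \<otimes>\<^bsub>?R\<^esub> \<theta> \<oplus>\<^bsub>?R\<^esub> \<psi> \<otimes>\<^bsub>?R\<^esub> \<theta>"
      using \<phi> \<psi> \<theta> by (intro eqI add mult) (simp_all add: val closed)
    show "\<theta> \<otimes>\<^bsub>?R\<^esub> (\<phi> \<oplus>\<^bsub>?R\<^esub> \<psi>) = \<theta> \<otimes>\<^bsub>?R\<^esub> \<phi> \<oplus>\<^bsub>?R\<^esub> \<theta> \<otimes>\<^bsub>?R\<^esub> \<psi>"
      using \<phi> \<psi> \<theta> by (intro eqI add mult) (simp_all add: val closed hom)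
  qed (simp_all add: one zero mult add)
qed

lemma wf_digraph_linear_quiver_3: "wf_digraph linear_quiver_3"
  by unfold_locales (auto simp: linear_quiver_3_def)

end

(* Endomorphisms of P_{Q,d} are block upper triangular matrices whose blocks are indexed by the
   vertices, and the radical consists of the strictly block triangular ones, that is of triples
   (X, Y, Z) of sizes l x d, d x m, l x m with product (X, Y, Z) (X', Y', Z') = (0, 0, X Y'). Hence Z and
   Z' are free (the factor q^(2lm)), and X Y' = X' Y says that the columns of the stacked matrix of Y' and
   Y are linear relations among the 2d columns of X and -X'. So the count is the sum of |ker w|^m over
   all families w of 2d vectors of k^l. The distribution of |ker w| follows by adding one vector at a
   time: a vector in the span of the family multiplies the kernel by q, any other vector leaves its
   size unchanged. This is the q-Pascal rule. *)

theory Submission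
  imports Defs "HOL-Algebra.QuotRing"
begin

section \<open>Kernels of families of vectors over a finite field\<close>

text \<open>Two vertices are joined by at most one path, so each summand contributes at most one
  coordinate to the space at a vertex, and arrows preserve coordinates. One matrix therefore
  describes a morphism at all vertices at once; an entry from a summand at i' to a summand at i
  needs a path from i to i', which is where triangularity comes from. The radical is an intersection
  of maximal left ideals, and these are visible for matrices but not for abstract endomorphisms. It
  is therefore computed for matrices and carried over by a ring isomorphism. Kernels and spans are
  measured by cardinality instead of dimension: n vectors with k relations span q^n / k vectors. The
  sum over families is evaluated for an arbitrary function g of the kernel size, because summing
  over one vector turns k^m into a combination of powers of k with different exponents, so a
  statement about k^m alone would not carry the induction.\<close>

definition gauss_binomial :: "'a::field \<Rightarrow> nat \<Rightarrow> nat \<Rightarrow> 'a" where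
  "gauss_binomial q n i = (\<Prod>j<i. (q ^ n - q ^ j) / (q ^ i - q ^ j))"

lemma gauss_binomial_0 [simp]: "gauss_binomial q n 0 = 1"
  by (simp add: gauss_binomial_def)

text \<open>The factor with j = n vanishes; sums over \<open>i\<close> may thus be extended past
  \<open>n\<close>.\<close>

lemma gauss_binomial_eq_0: "n < i \<Longrightarrow> gauss_binomial q n i = 0"
  by (auto simp: gauss_binomial_def)

text \<open>The factor with j = 0 is split off and \<open>q\<close> is pulled out of the other
  \<open>i\<close> factors. With n = i this also treats the denominator of the Gaussian
  binomial.\<close>

lemma prod_diff_power_Suc:
  fixes q :: "'a::field"
  shows "(\<Prod>j<Suc i. q ^ Suc n - q ^ j) = (q ^ Suc n - 1) * q ^ i * (\<Prod>j<i. q ^ n - q ^ j)"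
proof -
  have "(\<Prod>j<Suc i. q ^ Suc n - q ^ j) = (q ^ Suc n - 1) * (\<Prod>j<i. q * (q ^ n - q ^ j))"
    by (subst prod.lessThan_Suc_shift) (simp add: right_diff_distrib)
  also have "\<dots> = (q ^ Suc n - 1) * q ^ i * (\<Prod>j<i. q ^ n - q ^ j)"
    by (simp add: prod.distrib)
  finally show ?thesis .
qed

text \<open>Of the two q-Pascal rules this one has the factor q^(n - i): in the application this is
  the size of the span of n vectors with q^i relations, hence the number of new vectors that enlarge
  the kernel.\<close>

lemma gauss_binomial_Suc_Suc:
  fixes q :: real
  assumes "q > 1" "i \<le> n"
  shows "gauss_binomial q (Suc n) (Suc i) =
    gauss_binomial q n (Suc i) + q ^ (n - i) * gauss_binomial q n i"
proof -
  have D: "(\<Prod>j<k. q ^ k - q ^ j) \<noteq> 0" for k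
    using assms(1) by auto
  have q: "q ^ Suc i \<noteq> 1" "q \<noteq> 0"
    using assms(1) power_inject_exp[of q "Suc i" 0] by (auto simp del: power_Suc)
  have qn: "q ^ n = q ^ (n - i) * q ^ i"
    using assms(2) by (simp flip: power_add)
  \<comment> \<open>All three binomials are put over the denominator (q^(i+1) - 1) q^i C, so that
    only an identity of numerators remains.\<close>
  define A where "A = (\<Prod>j<i. q ^ n - q ^ j)"
  define C where "C = (\<Prod>j<i. q ^ i - q ^ j)"
  have "gauss_binomial q (Suc n) (Suc i) = ((q ^ Suc n - 1) * q ^ i * A) / ((q ^ Suc i - 1) * q ^ i * C)"
    by (simp only: gauss_binomial_def prod_dividef prod_diff_power_Suc A_def C_def)
  moreover have "gauss_binomial q n (Suc i) = (A * (q ^ n - q ^ i)) / ((q ^ Suc i - 1) * q ^ i * C)"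
    by (simp only: gauss_binomial_def prod_dividef prod_diff_power_Suc A_def C_def prod.lessThan_Suc)
  moreover have "gauss_binomial q n i = ((q ^ Suc i - 1) * q ^ i * A) / ((q ^ Suc i - 1) * q ^ i * C)"
    using q by (simp add: gauss_binomial_def prod_dividef A_def C_def del: power_Suc)
  moreover have "(q ^ Suc n - 1) * q ^ i * A = A * (q ^ n - q ^ i) + q ^ (n - i) * ((q ^ Suc i - 1) * q ^ i * A)"
    unfolding power_Suc qn by (simp add: algebra_simps)
  ultimately show ?thesis
    by (simp only: times_divide_eq_right add_divide_distrib)
qed

section \<open>Linear relations among a finite family of vectors\<close>

abbreviation lincomb ::
  "('k::field \<Rightarrow> 'v::ab_group_add \<Rightarrow> 'v) \<Rightarrow> 's set \<Rightarrow> ('s \<Rightarrow> 'v) \<Rightarrow> ('s \<Rightarrow> 'k) \<Rightarrow> 'v" where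
  "lincomb scale S w c \<equiv> \<Sum>s\<in>S. scale (c s) (w s)"

text \<open>Coefficients are \<open>undefined\<close> off \<open>S\<close>; otherwise one relation
  would be counted several times.\<close>

definition family_kernel ::
  "('k::field \<Rightarrow> 'v::ab_group_add \<Rightarrow> 'v) \<Rightarrow> 's set \<Rightarrow> ('s \<Rightarrow> 'v) \<Rightarrow> ('s \<Rightarrow> 'k) set" where
  "family_kernel scale S w = {c \<in> S \<rightarrow>\<^sub>E UNIV. lincomb scale S w c = 0}"

text \<open>The solutions of an inhomogeneous linear equation are a translate of the kernel by the
  particular solution \<open>c0\<close>.\<close>

lemma (in vector_space) card_comb_fibre:
  fixes S :: "'s set" and w :: "'s \<Rightarrow> 'b"
  assumes "c0 \<in> S \<rightarrow>\<^sub>E UNIV"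
  shows "card {c \<in> S \<rightarrow>\<^sub>E UNIV. lincomb scale S w c = lincomb scale S w c0} = card (family_kernel scale S w)"
proof (rule bij_betw_same_card)
  show "bij_betw (\<lambda>c. \<lambda>s\<in>S. c s - c0 s) {c \<in> S \<rightarrow>\<^sub>E UNIV. lincomb scale S w c = lincomb scale S w c0}
      (family_kernel scale S w)"
    by (rule bij_betw_byWitness[where f' = "\<lambda>c. \<lambda>s\<in>S. c s + c0 s"])
      (use assms in \<open>auto simp: family_kernel_def scale_left_diff_distrib scale_left_distrib
        sum_subtractf sum.distrib fun_eq_iff PiE_iff extensional_def\<close>)
qed

text \<open>Rank-nullity in multiplicative form: the coefficient functions are sorted by their
  value, and all nonempty fibres have the size of the kernel.\<close>

lemma (in vector_space) card_comb_image:
  fixes S :: "'s set" and w :: "'s \<Rightarrow> 'b"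
  assumes fin: "finite (UNIV :: 'a set)" and S: "finite S"
  shows "card (lincomb scale S w ` (S \<rightarrow>\<^sub>E UNIV)) * card (family_kernel scale S w) = CARD('a) ^ card S"
proof -
  have finP: "finite (S \<rightarrow>\<^sub>E (UNIV :: 'a set))"
    using fin S by (intro finite_PiE) auto
  have "CARD('a) ^ card S = card (S \<rightarrow>\<^sub>E (UNIV :: 'a set))"
    using S by (simp add: card_funcsetE)
  also have "\<dots> = (\<Sum>v \<in> lincomb scale S w ` (S \<rightarrow>\<^sub>E UNIV). card {c \<in> S \<rightarrow>\<^sub>E UNIV. lincomb scale S w c = v})"
    unfolding card_eq_sum by (rule sum.image_gen[OF finP])
  also have "\<dots> = (\<Sum>v \<in> lincomb scale S w ` (S \<rightarrow>\<^sub>E UNIV). card (family_kernel scale S w))"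
    by (rule sum.cong[OF refl]) (use card_comb_fibre in blast)
  finally show ?thesis by simp
qed

text \<open>A relation of the larger family is a coefficient \<open>a\<close> for \<open>v\<close>
  together with a combination of the old vectors equal to -a v. If \<open>v\<close> lies in their
  span, every \<open>a\<close> contributes a translate of the old kernel; otherwise only a = 0
  contributes.\<close>

lemma (in vector_space) card_family_kernel_insert:
  fixes S :: "'s set" and w :: "'s \<Rightarrow> 'b"
  assumes fin: "finite (UNIV :: 'a set)" and S: "finite S" "s \<notin> S"
  shows "card (family_kernel scale (insert s S) (w(s := v))) =
    (if v \<in> lincomb scale S w ` (S \<rightarrow>\<^sub>E UNIV) then CARD('a) else 1) * card (family_kernel scale S w)"
proof -
  let ?F = "\<lambda>a. {c \<in> S \<rightarrow>\<^sub>E UNIV. lincomb scale S w c = - scale a v}"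
  have finP: "finite (S \<rightarrow>\<^sub>E (UNIV :: 'a set))"
    using fin S by (intro finite_PiE) auto
  have comb_cong: "lincomb scale S (w(s := v)) (c(s := a)) = lincomb scale S w c" for c a
    by (rule sum.cong) (use S in auto)
  have "family_kernel scale (insert s S) (w(s := v)) = (\<lambda>(a, c). c(s := a)) ` (SIGMA a:UNIV. ?F a)"
    using S comb_cong
    by (auto simp: family_kernel_def PiE_insert_eq image_iff Bex_def eq_neg_iff_add_eq_0 add.commute)
  moreover have "inj_on (\<lambda>(a, c). c(s := a)) (SIGMA a:UNIV. ?F a)"
    by (rule inj_on_subset[OF inj_combinator[OF S(2), of "\<lambda>_. UNIV"]]) auto
  ultimately have card: "card (family_kernel scale (insert s S) (w(s := v))) = (\<Sum>a\<in>UNIV. card (?F a))"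
    using fin finP by (simp add: card_image card_SigmaI)
  show ?thesis
  proof (cases "v \<in> lincomb scale S w ` (S \<rightarrow>\<^sub>E UNIV)")
    case True
    then obtain c0 where c0: "c0 \<in> S \<rightarrow>\<^sub>E UNIV" "v = lincomb scale S w c0" by auto
    have "card (?F a) = card (family_kernel scale S w)" for a
    proof -
      have "lincomb scale S w (\<lambda>s\<in>S. - a * c0 s) = - scale a v"
        by (simp add: c0(2) scale_sum_right sum_negf cong: sum.cong)
      with card_comb_fibre[of "\<lambda>s\<in>S. - a * c0 s" S w] show ?thesis by simp
    qed
    with True card show ?thesis by simp
  next
    case False
    have empty: "?F a = {}" if "a \<noteq> 0" for a
    proof (rule ccontr)
      assume "?F a \<noteq> {}"
      then obtain c where c: "lincomb scale S w c = - scale a v" by auto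
      \<comment> \<open>Dividing by -a turns a combination equal to -a v into one equal to
        \<open>v\<close>.\<close>
      have "lincomb scale S w (\<lambda>s\<in>S. - inverse a * c s) = - scale (inverse a) (lincomb scale S w c)"
        by (simp add: scale_sum_right sum_negf cong: sum.cong)
      also have "\<dots> = v" using that by (simp add: c)
      finally have "v \<in> lincomb scale S w ` (S \<rightarrow>\<^sub>E UNIV)"
        by (intro image_eqI[where x = "\<lambda>s\<in>S. - inverse a * c s"]) auto
      with False show False by simp
    qed
    have card_F: "card (?F a) = 0" if "a \<noteq> 0" for a
      unfolding empty[OF that] by (rule card.empty)
    have "(\<Sum>a\<in>UNIV. card (?F a)) = (\<Sum>a\<in>{0}. card (?F a))"
      by (rule sum.mono_neutral_right) (use fin card_F in blast)+
    also have "\<dots> = card (family_kernel scale S w)"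
      using fin by (simp add: family_kernel_def)
    finally show ?thesis using False card by simp
  qed
qed

text \<open>Induction on the family for all \<open>g\<close> at once: summing over the last vector
  replaces \<open>g\<close> by a function \<open>g'\<close> of the kernel size of the remaining
  family, and the induction hypothesis is applied to \<open>g'\<close>. The coefficient of g(q^i) is
  the number of families with q^i relations.\<close>

lemma (in vector_space) sum_card_family_kernel:
  fixes S :: "'s set" and V :: "'b set" and g :: "nat \<Rightarrow> real"
  assumes fin: "finite (UNIV :: 'a set)" and S: "finite S"
    and V: "subspace V" "finite V" "card V = CARD('a) ^ l"
  defines "q \<equiv> real CARD('a)"
  shows "(\<Sum>w \<in> S \<rightarrow>\<^sub>E V. g (card (family_kernel scale S w))) =
    (\<Sum>i\<le>card S. g (CARD('a) ^ i) * gauss_binomial q (card S) i * (\<Prod>j<card S - i. q ^ l - q ^ j))"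
  using S
proof (induction S arbitrary: g rule: finite_induct)
  case empty
  then show ?case by (simp add: family_kernel_def)
next
  case (insert s S)
  let ?n = "card S" and ?E = "\<lambda>k. \<Prod>j<k. q ^ l - q ^ j" and ?Q = "CARD('a)"
  have q1: "q > 1"
    using fin card_mono[OF fin, of "{0, 1}"] unfolding q_def by simp
  \<comment> \<open>With \<open>k\<close> relations the span of the \<open>?n\<close> vectors has
    q^n / k elements. The two coefficients count the new vectors inside the span and those of
    \<open>V\<close> outside it.\<close>
  define g' where "g' k = q ^ ?n / real k * g (?Q * k) + (q ^ l - q ^ ?n / real k) * g k" for k
  have step: "(\<Sum>v\<in>V. g (card (family_kernel scale (insert s S) (w(s := v))))) = g' (card (family_kernel scale S w))"
    if w: "w \<in> S \<rightarrow>\<^sub>E V" for w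
  proof -
    define I where "I = lincomb scale S w ` (S \<rightarrow>\<^sub>E UNIV)"
    let ?k = "card (family_kernel scale S w)"
    have sub: "I \<subseteq> V"
      unfolding I_def using V(1) w by (auto intro!: subspace_sum subspace_scale)
    have "real (card I) * real ?k = q ^ ?n"
      unfolding I_def q_def of_nat_mult[symmetric] card_comb_image[OF fin insert.hyps(1)] by simp
    moreover have "q ^ ?n \<noteq> 0" using q1 by simp
    ultimately have I: "real (card I) = q ^ ?n / real ?k"
      by (metis mult_zero_right nonzero_eq_divide_eq)
    have "card (V - I) = card V - card I" "card I \<le> card V"
      using sub V(2) by (auto simp: card_Diff_subset finite_subset card_mono)
    then have VI: "real (card (V - I)) = q ^ l - q ^ ?n / real ?k"
      using V(3) I by (simp add: of_nat_diff q_def)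
    have "(\<Sum>v\<in>V. g (card (family_kernel scale (insert s S) (w(s := v))))) =
        (\<Sum>v\<in>V. if v \<in> I then g (?Q * ?k) else g ?k)"
      unfolding card_family_kernel_insert[OF fin insert.hyps(1,2)] I_def[symmetric]
      by (intro sum.cong) auto
    also have "\<dots> = real (card (V \<inter> I)) * g (?Q * ?k) + real (card (V - I)) * g ?k"
      using V(2) by (simp add: sum.If_cases Diff_eq)
    also have "V \<inter> I = I" using sub by blast
    finally show ?thesis unfolding g'_def I VI .
  qed
  have "(\<Sum>w \<in> insert s S \<rightarrow>\<^sub>E V. g (card (family_kernel scale (insert s S) w))) =
      (\<Sum>(v, w) \<in> V \<times> (S \<rightarrow>\<^sub>E V). g (card (family_kernel scale (insert s S) (w(s := v)))))"
    unfolding PiE_insert_eq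
    by (subst sum.reindex[OF inj_combinator[OF insert.hyps(2)]]) (simp add: case_prod_unfold)
  also have "\<dots> = (\<Sum>w \<in> S \<rightarrow>\<^sub>E V. g' (card (family_kernel scale S w)))"
    by (subst sum.cartesian_product[symmetric], subst sum.swap) (simp add: step)
  also have "\<dots> = (\<Sum>i\<le>?n. g' (?Q ^ i) * gauss_binomial q ?n i * ?E (?n - i))"
    by (rule insert.IH)
  \<comment> \<open>For k = q^i the span has q^(n - i) elements, so q^l - q^(n - i) is exactly the
    next factor of the product \<open>?E\<close>.\<close>
  also have "\<dots> = (\<Sum>i\<le>?n. g (?Q ^ Suc i) * (q ^ (?n - i) * gauss_binomial q ?n i) * ?E (?n - i))
      + (\<Sum>i\<le>?n. g (?Q ^ i) * gauss_binomial q ?n i * ?E (Suc ?n - i))"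
    unfolding sum.distrib[symmetric]
  proof (rule sum.cong[OF refl])
    fix i assume "i \<in> {..?n}"
    then have "q ^ ?n / real (?Q ^ i) = q ^ (?n - i)" "Suc ?n - i = Suc (?n - i)"
      using q1 by (auto simp: q_def power_diff)
    then show "g' (?Q ^ i) * gauss_binomial q ?n i * ?E (?n - i) =
        g (?Q ^ Suc i) * (q ^ (?n - i) * gauss_binomial q ?n i) * ?E (?n - i)
        + g (?Q ^ i) * gauss_binomial q ?n i * ?E (Suc ?n - i)"
      unfolding g'_def by (simp add: algebra_simps)
  qed
  \<comment> \<open>The added last term has a vanishing Gaussian binomial. With it the index can be
    shifted, and the q-Pascal rule merges the two sums term by term.\<close>
  also have "(\<Sum>i\<le>?n. g (?Q ^ i) * gauss_binomial q ?n i * ?E (Suc ?n - i)) =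
      (\<Sum>i\<le>Suc ?n. g (?Q ^ i) * gauss_binomial q ?n i * ?E (Suc ?n - i))"
    by (simp add: gauss_binomial_eq_0)
  also have "\<dots> = g 1 * ?E (Suc ?n) + (\<Sum>i\<le>?n. g (?Q ^ Suc i) * gauss_binomial q ?n (Suc i) * ?E (?n - i))"
    by (subst sum.atMost_Suc_shift) simp
  also have "(\<Sum>i\<le>?n. g (?Q ^ Suc i) * (q ^ (?n - i) * gauss_binomial q ?n i) * ?E (?n - i)) + \<dots>
      = g 1 * ?E (Suc ?n) + (\<Sum>i\<le>?n. g (?Q ^ Suc i) * gauss_binomial q (Suc ?n) (Suc i) * ?E (?n - i))"
    unfolding add.left_commute[of _ "g 1 * ?E (Suc ?n)"] sum.distrib[symmetric]
    by (intro arg_cong2[where f = "(+)"] sum.cong refl)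
      (simp add: gauss_binomial_Suc_Suc[OF q1] distrib_left distrib_right)
  also have "\<dots> = (\<Sum>i\<le>Suc ?n. g (?Q ^ i) * gauss_binomial q (Suc ?n) i * ?E (Suc ?n - i))"
    by (simp add: sum.atMost_Suc_shift del: sum.atMost_Suc prod.lessThan_Suc)
  finally show ?case using insert.hyps by simp
qed

section \<open>The Jacobson radical under isomorphisms and for block triangular matrices\<close>

lemma left_idealD:
  assumes "left_ideal I R"
  shows "I \<subseteq> carrier R" "\<zero>\<^bsub>R\<^esub> \<in> I"
    "\<And>x y. x \<in> I \<Longrightarrow> y \<in> I \<Longrightarrow> x \<oplus>\<^bsub>R\<^esub> y \<in> I"
    "\<And>a x. a \<in> carrier R \<Longrightarrow> x \<in> I \<Longrightarrow> a \<otimes>\<^bsub>R\<^esub> x \<in> I"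
  using assms subgroup.subset subgroup.one_closed subgroup.m_closed
  unfolding left_ideal_def by fastforce+

context ring
begin

text \<open>Closure under negation follows from -x = (-1) x.\<close>

lemma left_idealI:
  assumes "I \<subseteq> carrier R" "\<zero> \<in> I"
    and add: "\<And>x y. x \<in> I \<Longrightarrow> y \<in> I \<Longrightarrow> x \<oplus> y \<in> I"
    and mult: "\<And>a x. a \<in> carrier R \<Longrightarrow> x \<in> I \<Longrightarrow> a \<otimes> x \<in> I"
  shows "left_ideal I R"
proof -
  have "\<ominus> x \<in> I" if "x \<in> I" for x
  proof -
    have "\<ominus> x = (\<ominus> \<one>) \<otimes> x"
      using that assms(1) by (auto simp: l_minus)
    then show ?thesis using mult[OF _ that] by simp
  qed
  then show ?thesis
    using assms by (auto simp: left_ideal_def subgroup_def a_inv_def)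
qed

lemma left_ideal_eq_carrier:
  assumes "left_ideal I R" "\<one> \<in> I"
  shows "I = carrier R"
proof -
  have "x \<in> I" if "x \<in> carrier R" for x
    using left_idealD(4)[OF assms(1) that assms(2)] that by simp
  with left_idealD(1)[OF assms(1)] show ?thesis by blast
qed

text \<open>If \<open>x\<close> were outside \<open>I\<close>, maximality would give 1 = y + a x
  with \<open>y\<close> in \<open>I\<close>. Substituting this for the 1 in (a x)^k 1 puts 1 into I
  + (a x)^k for every \<open>k\<close>, since left multiples of \<open>y\<close> stay in
  \<open>I\<close>; nilpotency then puts 1 into \<open>I\<close>.\<close>

lemma mem_maximal_left_ideal_of_nilpotent:
  fixes n :: nat
  assumes I: "maximal_left_ideal I R" and x: "x \<in> carrier R"
    and nil: "\<And>a. a \<in> carrier R \<Longrightarrow> (a \<otimes> x) [^] n = \<zero>"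
  shows "x \<in> I"
proof (rule ccontr)
  assume xI: "x \<notin> I"
  have L: "left_ideal I R" using I by (simp add: maximal_left_ideal_def)
  note LD = left_idealD[OF L]
  let ?J = "{y \<oplus> a \<otimes> x | y a. y \<in> I \<and> a \<in> carrier R}"
  have "left_ideal ?J R"
  proof (rule left_idealI)
    show "?J \<subseteq> carrier R" using LD(1) x by auto
    show "\<zero> \<in> ?J" using LD(2) x by (auto intro!: exI[of _ \<zero>])
  next
    fix u v assume "u \<in> ?J" "v \<in> ?J"
    then obtain y a z b where uv: "u = y \<oplus> a \<otimes> x" "v = z \<oplus> b \<otimes> x" "y \<in> I" "z \<in> I"
      "a \<in> carrier R" "b \<in> carrier R" by blast
    moreover have "y \<in> carrier R" "z \<in> carrier R" using uv LD(1) by auto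
    ultimately have "u \<oplus> v = (y \<oplus> z) \<oplus> (a \<oplus> b) \<otimes> x"
      using x by (simp add: l_distr a_ac)
    then show "u \<oplus> v \<in> ?J" using uv LD(3) by blast
  next
    fix c u assume "u \<in> ?J" and c: "c \<in> carrier R"
    then obtain y a where u: "u = y \<oplus> a \<otimes> x" "y \<in> I" "a \<in> carrier R" by blast
    moreover have "y \<in> carrier R" using u LD(1) by auto
    ultimately have "c \<otimes> u = c \<otimes> y \<oplus> (c \<otimes> a) \<otimes> x"
      using x c by (simp add: r_distr m_assoc)
    then show "c \<otimes> u \<in> ?J" using u LD(4) c by blast
  qed
  moreover have "I \<subseteq> ?J"
  proof
    fix y assume y: "y \<in> I"
    then have "y = y \<oplus> \<zero> \<otimes> x" using LD(1) x by auto
    then show "y \<in> ?J" using y by blast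
  qed
  moreover have "x \<in> ?J"
  proof -
    have "x = \<zero> \<oplus> \<one> \<otimes> x" using x by simp
    then show ?thesis using LD(2) by blast
  qed
  ultimately have "?J = carrier R"
    using I xI unfolding maximal_left_ideal_def by blast
  then have "\<one> \<in> ?J" by simp
  then obtain y a where y: "\<one> = y \<oplus> a \<otimes> x" "y \<in> I" "a \<in> carrier R" by blast
  have yc: "y \<in> carrier R" and zc: "a \<otimes> x \<in> carrier R" using y LD(1) x by auto
  have "\<exists>w\<in>I. \<one> = w \<oplus> (a \<otimes> x) [^] k" for k :: nat
  proof (induction k)
    case 0
    then show ?case using LD(2) by (auto intro!: bexI[of _ \<zero>])
  next
    case (Suc k)
    then obtain w where w: "w \<in> I" "\<one> = w \<oplus> (a \<otimes> x) [^] k" by blast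
    let ?z = "(a \<otimes> x) [^] k"
    have zk: "?z \<in> carrier R" using zc by simp
    have "w \<oplus> ?z \<otimes> \<one> = \<one>"
      using zk by (simp flip: w(2))
    then have "\<one> = w \<oplus> ?z \<otimes> (y \<oplus> a \<otimes> x)"
      by (simp flip: y(1))
    also have "\<dots> = (w \<oplus> ?z \<otimes> y) \<oplus> ?z \<otimes> (a \<otimes> x)"
      using w(1) LD(1) zk zc yc by (auto simp: r_distr a_assoc)
    finally show ?case
      using LD(3)[OF w(1) LD(4)[OF zk y(2)]] by auto
  qed
  from this[of n] have "\<one> \<in> I"
    using nil[OF y(3)] LD(1) by auto
  then show False
    using left_ideal_eq_carrier[OF L] I by (simp add: maximal_left_ideal_def)
qed

section \<open>Invariance under ring isomorphisms\<close>

lemma ring_iso_image_left_ideal: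
  assumes "ring S" "h \<in> ring_iso R S" "left_ideal I R"
  shows "left_ideal (h ` I) S"
proof -
  interpret S: ring S by fact
  have h: "h \<in> ring_hom R S" "h ` carrier R = carrier S"
    using assms(2) by (auto simp: ring_iso_def bij_betw_def)
  interpret h: ring_hom_ring R S h
    by unfold_locales (use h(1) in auto)
  note ID = left_idealD[OF assms(3)]
  show ?thesis
  proof (rule S.left_idealI)
    show "h ` I \<subseteq> carrier S" using ID(1) h(2) by auto
    show "\<zero>\<^bsub>S\<^esub> \<in> h ` I" using ID(2) h.hom_zero by (metis image_eqI)
  next
    fix x y assume "x \<in> h ` I" "y \<in> h ` I"
    then obtain u v where uv: "x = h u" "y = h v" "u \<in> I" "v \<in> I" by blast
    then have "x \<oplus>\<^bsub>S\<^esub> y = h (u \<oplus> v)"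
      using ID(1) by (auto simp: subset_iff ring_hom_add[OF h(1)])
    then show "x \<oplus>\<^bsub>S\<^esub> y \<in> h ` I" using ID(3) uv by blast
  next
    fix x y assume "x \<in> carrier S" "y \<in> h ` I"
    then obtain u v where uv: "x = h u" "y = h v" "u \<in> carrier R" "v \<in> I" using h(2) by blast
    then have "x \<otimes>\<^bsub>S\<^esub> y = h (u \<otimes> v)"
      using ID(1) by (auto simp: subset_iff ring_hom_mult[OF h(1)])
    then show "x \<otimes>\<^bsub>S\<^esub> y \<in> h ` I" using ID(4) uv by blast
  qed
qed

end

lemma ring_iso_image_inv_into:
  assumes "h \<in> ring_iso R S" "J \<subseteq> carrier S"
  shows "h ` inv_into (carrier R) h ` J = J"
  using assms by (auto simp: ring_iso_def bij_betw_def image_image f_inv_into_f subset_iff image_iff)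

text \<open>A left ideal above the image of \<open>I\<close> is pulled back along the inverse
  isomorphism and compared with \<open>I\<close> there.\<close>

lemma ring_iso_image_maximal_left_ideal:
  assumes R: "ring R" and S: "ring S" and h: "h \<in> ring_iso R S" and I: "maximal_left_ideal I R"
  shows "maximal_left_ideal (h ` I) S"
proof -
  let ?g = "inv_into (carrier R) h"
  have bij: "inj_on h (carrier R)" "h ` carrier R = carrier S"
    using h by (auto simp: ring_iso_def bij_betw_def)
  have L: "left_ideal I R" "I \<subseteq> carrier R" "I \<noteq> carrier R"
    using I left_idealD(1) by (auto simp: maximal_left_ideal_def)
  have "J = h ` I \<or> J = carrier S" if J: "left_ideal J S" "h ` I \<subseteq> J" for J
  proof -
    have "left_ideal (?g ` J) R"
      using ring.ring_iso_image_left_ideal[OF S R ring_iso_set_sym[OF R h] J(1)] .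
    moreover have "I \<subseteq> ?g ` J"
    proof
      fix x assume x: "x \<in> I"
      then have "?g (h x) = x" using bij(1) L(2) by auto
      then show "x \<in> ?g ` J" using x J(2) by (metis image_eqI image_subset_iff)
    qed
    ultimately have "?g ` J = I \<or> ?g ` J = carrier R"
      using I by (simp add: maximal_left_ideal_def)
    then show ?thesis
      using ring_iso_image_inv_into[OF h left_idealD(1)[OF J(1)]] bij(2) by metis
  qed
  moreover have "h ` I \<noteq> carrier S"
    using L(2,3) bij inj_on_image_eq_iff[OF bij(1), of I "carrier R"] by auto
  ultimately show ?thesis
    using ring.ring_iso_image_left_ideal[OF R S h L(1)] by (auto simp: maximal_left_ideal_def)
qed

lemma ring_iso_image_jacobson_radical_subset:
  assumes R: "ring R" and S: "ring S" and h: "h \<in> ring_iso R S"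
  shows "h ` jacobson_radical R \<subseteq> jacobson_radical S"
proof
  fix y assume "y \<in> h ` jacobson_radical R"
  then obtain x where x: "y = h x" "x \<in> jacobson_radical R" by blast
  then have xc: "x \<in> carrier R" by (simp add: jacobson_radical_def)
  have yc: "y \<in> carrier S" using x(1) xc h by (auto simp: ring_iso_def bij_betw_def)
  moreover have "y \<in> I" if I: "maximal_left_ideal I S" for I
  proof -
    let ?g = "inv_into (carrier R) h"
    have "maximal_left_ideal (?g ` I) R"
      using ring_iso_image_maximal_left_ideal[OF S R ring_iso_set_sym[OF R h] I] .
    then have "x \<in> ?g ` I" using x(2) by (simp add: jacobson_radical_def)
    then have "y \<in> h ` ?g ` I" using x(1) by blast
    then show ?thesis
      using ring_iso_image_inv_into[OF h] I left_idealD(1) by (metis maximal_left_ideal_def)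
  qed
  ultimately show "y \<in> jacobson_radical S" by (simp add: jacobson_radical_def)
qed

text \<open>The reverse inclusion is the forward one for the inverse isomorphism, pushed along
  \<open>h\<close>.\<close>

lemma ring_iso_image_jacobson_radical:
  assumes R: "ring R" and S: "ring S" and h: "h \<in> ring_iso R S"
  shows "h ` jacobson_radical R = jacobson_radical S"
proof
  let ?g = "inv_into (carrier R) h"
  have "jacobson_radical S = h ` ?g ` jacobson_radical S"
    using ring_iso_image_inv_into[OF h] by (simp add: jacobson_radical_def)
  also have "\<dots> \<subseteq> h ` jacobson_radical R"
    by (rule image_mono) (rule ring_iso_image_jacobson_radical_subset[OF S R ring_iso_set_sym[OF R h]])
  finally show "jacobson_radical S \<subseteq> h ` jacobson_radical R" .
qed (rule ring_iso_image_jacobson_radical_subset[OF assms])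

definition commuting_pairs :: "'a set \<Rightarrow> ('a, 'b) ring_scheme \<Rightarrow> ('a \<times> 'a) set" where
  "commuting_pairs X R = {(x, y). x \<in> X \<and> y \<in> X \<and> x \<otimes>\<^bsub>R\<^esub> y = y \<otimes>\<^bsub>R\<^esub> x}"

lemma ring_iso_card_commuting_pairs:
  assumes R: "ring R" and h: "h \<in> ring_iso R S" and X: "X \<subseteq> carrier R"
  shows "card (commuting_pairs (h ` X) S) = card (commuting_pairs X R)"
proof (rule bij_betw_same_card[symmetric])
  interpret ring R by fact
  have inj: "inj_on h (carrier R)" and hm: "h \<in> ring_hom R S"
    using h by (auto simp: ring_iso_def bij_betw_def)
  have comm: "h x \<otimes>\<^bsub>S\<^esub> h y = h y \<otimes>\<^bsub>S\<^esub> h x \<longleftrightarrow> x \<otimes>\<^bsub>R\<^esub> y = y \<otimes>\<^bsub>R\<^esub> x"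
    if "x \<in> X" "y \<in> X" for x y
  proof -
    have xy: "x \<in> carrier R" "y \<in> carrier R" using that X by auto
    then show ?thesis
      using inj_on_eq_iff[OF inj, of "x \<otimes>\<^bsub>R\<^esub> y" "y \<otimes>\<^bsub>R\<^esub> x"] by (simp add: ring_hom_mult[OF hm])
  qed
  have injX: "inj_on h X" using inj X by (rule inj_on_subset)
  show "bij_betw (map_prod h h) (commuting_pairs X R) (commuting_pairs (h ` X) S)"
    unfolding bij_betw_def
  proof
    show "inj_on (map_prod h h) (commuting_pairs X R)"
      using inj_onD[OF injX] by (auto simp: inj_on_def commuting_pairs_def)
    show "map_prod h h ` commuting_pairs X R = commuting_pairs (h ` X) S"
    proof (intro subset_antisym subsetI)
      fix z assume "z \<in> commuting_pairs (h ` X) S"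
      then obtain x y where "z = map_prod h h (x, y)" "x \<in> X" "y \<in> X"
        "h x \<otimes>\<^bsub>S\<^esub> h y = h y \<otimes>\<^bsub>S\<^esub> h x"
        by (auto simp: commuting_pairs_def)
      moreover from this have "(x, y) \<in> commuting_pairs X R"
        using comm by (auto simp: commuting_pairs_def)
      ultimately show "z \<in> map_prod h h ` commuting_pairs X R" by blast
    qed (auto simp: commuting_pairs_def comm)
  qed
qed

section \<open>Block triangular matrices and their radical\<close>

definition block_triangular_ring :: "'b set \<Rightarrow> ('b \<Rightarrow> nat) \<Rightarrow> ('b \<Rightarrow> 'b \<Rightarrow> 'k::field) ring" where
  "block_triangular_ring B lev =
    \<lparr>carrier = {x. \<forall>b b'. x b b' \<noteq> 0 \<longrightarrow> b \<in> B \<and> b' \<in> B \<and> lev b \<le> lev b'},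
     mult = (\<lambda>x y b b'. \<Sum>e\<in>B. x b e * y e b'),
     one = (\<lambda>b b'. if b \<in> B \<and> b' = b then 1 else 0),
     zero = (\<lambda>b b'. 0),
     add = (\<lambda>x y b b'. x b b' + y b b')\<rparr>"

text \<open>As in the ring above, matrices are total functions vanishing off \<open>B\<close>, so
  that equality of matrices is equality of functions. The blocks are the fibres of
  \<open>lev\<close>.\<close>

definition strictly_block_triangular :: "'b set \<Rightarrow> ('b \<Rightarrow> nat) \<Rightarrow> ('b \<Rightarrow> 'b \<Rightarrow> 'k::field) set" where
  "strictly_block_triangular B lev = {x. \<forall>b b'. x b b' \<noteq> 0 \<longrightarrow> b \<in> B \<and> b' \<in> B \<and> lev b < lev b'}"

lemma nonzero_sum_mult:
  fixes x y :: "'b \<Rightarrow> 'b \<Rightarrow> 'k::field"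
  assumes "(\<Sum>e\<in>B. x b e * y e b') \<noteq> 0"
  obtains e where "e \<in> B" "x b e \<noteq> 0" "y e b' \<noteq> 0"
  using assms by (auto elim: sum.not_neutral_contains_not_neutral)

lemma ring_block_triangular_ring:
  assumes B: "finite B"
  shows "ring (block_triangular_ring B lev :: ('b \<Rightarrow> 'b \<Rightarrow> 'k::field) ring)" (is "ring ?R")
proof -
  have mult: "(x \<otimes>\<^bsub>?R\<^esub> y) b b' = (\<Sum>e\<in>B. x b e * y e b')" and add: "(x \<oplus>\<^bsub>?R\<^esub> y) b b' = x b b' + y b b'"
    and one: "\<one>\<^bsub>?R\<^esub> b b' = (if b \<in> B \<and> b' = b then 1 else 0)" and zero: "\<zero>\<^bsub>?R\<^esub> b b' = 0"
    for x y b b'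
    by (simp_all add: block_triangular_ring_def)
  have carrier: "x \<in> carrier ?R \<longleftrightarrow> (\<forall>b b'. x b b' \<noteq> 0 \<longrightarrow> b \<in> B \<and> b' \<in> B \<and> lev b \<le> lev b')" for x
    by (simp add: block_triangular_ring_def)
  show ?thesis
  proof (intro ringI abelian_groupI monoidI)
    show "\<one>\<^bsub>?R\<^esub> \<in> carrier ?R" "\<zero>\<^bsub>?R\<^esub> \<in> carrier ?R"
      by (simp_all add: carrier one zero)
    fix x assume x: "x \<in> carrier ?R"
    show "\<exists>y\<in>carrier ?R. y \<oplus>\<^bsub>?R\<^esub> x = \<zero>\<^bsub>?R\<^esub>"
      by (rule bexI[of _ "\<lambda>b b'. - x b b'"]) (use x in \<open>simp_all add: carrier fun_eq_iff add zero\<close>)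
    have supp: "x b b' = 0" if "b \<notin> B \<or> b' \<notin> B" for b b'
      using x that unfolding carrier by blast
    have "(\<one>\<^bsub>?R\<^esub> \<otimes>\<^bsub>?R\<^esub> x) b b' = x b b'" for b b'
    proof -
      have "(\<one>\<^bsub>?R\<^esub> \<otimes>\<^bsub>?R\<^esub> x) b b' = (\<Sum>e\<in>B. if e = b then x e b' else 0)"
        unfolding mult one by (rule sum.cong) auto
      then show ?thesis using B supp[of b b'] by auto
    qed
    then show "\<one>\<^bsub>?R\<^esub> \<otimes>\<^bsub>?R\<^esub> x = x" by (intro ext)
    have "(x \<otimes>\<^bsub>?R\<^esub> \<one>\<^bsub>?R\<^esub>) b b' = x b b'" for b b'
    proof -
      have "(x \<otimes>\<^bsub>?R\<^esub> \<one>\<^bsub>?R\<^esub>) b b' = (\<Sum>e\<in>B. if b' = e then x b e else 0)"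
        unfolding mult one by (rule sum.cong) auto
      then show ?thesis using B supp[of b b'] by auto
    qed
    then show "x \<otimes>\<^bsub>?R\<^esub> \<one>\<^bsub>?R\<^esub> = x" by (intro ext)
    show "\<zero>\<^bsub>?R\<^esub> \<oplus>\<^bsub>?R\<^esub> x = x" by (simp add: fun_eq_iff add zero)
    fix y assume y: "y \<in> carrier ?R"
    show "x \<oplus>\<^bsub>?R\<^esub> y = y \<oplus>\<^bsub>?R\<^esub> x" by (simp add: fun_eq_iff add add.commute)
    have "x b b' \<noteq> 0 \<or> y b b' \<noteq> 0" if "x b b' + y b b' \<noteq> 0" for b b'
      using that by auto
    then show "x \<oplus>\<^bsub>?R\<^esub> y \<in> carrier ?R"
      using x y unfolding carrier add by blast
    show "x \<otimes>\<^bsub>?R\<^esub> y \<in> carrier ?R"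
      unfolding carrier mult
    proof (intro allI impI)
      fix b b' assume "(\<Sum>e\<in>B. x b e * y e b') \<noteq> 0"
      then obtain e where "x b e \<noteq> 0" "y e b' \<noteq> 0" by (rule nonzero_sum_mult)
      then show "b \<in> B \<and> b' \<in> B \<and> lev b \<le> lev b'"
        using x[unfolded carrier, rule_format, of b e] y[unfolded carrier, rule_format, of e b'] by simp
    qed
    fix z
    show "x \<oplus>\<^bsub>?R\<^esub> y \<oplus>\<^bsub>?R\<^esub> z = x \<oplus>\<^bsub>?R\<^esub> (y \<oplus>\<^bsub>?R\<^esub> z)"
      by (simp add: fun_eq_iff add add.assoc)
    show "(x \<oplus>\<^bsub>?R\<^esub> y) \<otimes>\<^bsub>?R\<^esub> z = x \<otimes>\<^bsub>?R\<^esub> z \<oplus>\<^bsub>?R\<^esub> y \<otimes>\<^bsub>?R\<^esub> z"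
      "z \<otimes>\<^bsub>?R\<^esub> (x \<oplus>\<^bsub>?R\<^esub> y) = z \<otimes>\<^bsub>?R\<^esub> x \<oplus>\<^bsub>?R\<^esub> z \<otimes>\<^bsub>?R\<^esub> y"
      by (simp_all add: fun_eq_iff add mult distrib_left distrib_right sum.distrib)
    have "(\<Sum>e\<in>B. (\<Sum>e'\<in>B. x b e' * y e' e) * z e b') = (\<Sum>e'\<in>B. x b e' * (\<Sum>e\<in>B. y e' e * z e b'))" for b b'
      unfolding sum_distrib_left sum_distrib_right by (subst sum.swap) (simp add: mult.assoc)
    then show "x \<otimes>\<^bsub>?R\<^esub> y \<otimes>\<^bsub>?R\<^esub> z = x \<otimes>\<^bsub>?R\<^esub> (y \<otimes>\<^bsub>?R\<^esub> z)"
      by (simp add: fun_eq_iff mult)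
  qed
qed

text \<open>This left ideal is the annihilator of a standard basis vector of the simple module belonging to
  the diagonal block of \<open>e\<close>.\<close>

lemma maximal_left_ideal_block_column:
  fixes lev :: "'b \<Rightarrow> nat"
  assumes B: "finite B" and e: "e \<in> B"
  defines "R \<equiv> (block_triangular_ring B lev :: ('b \<Rightarrow> 'b \<Rightarrow> 'k::field) ring)"
  shows "maximal_left_ideal {x \<in> carrier R. \<forall>b. lev b = lev e \<longrightarrow> x b e = 0} R" (is "maximal_left_ideal ?L R")
proof -
  interpret ring R unfolding R_def by (rule ring_block_triangular_ring[OF B])
  have carrier: "x \<in> carrier R \<longleftrightarrow> (\<forall>b b'. x b b' \<noteq> 0 \<longrightarrow> b \<in> B \<and> b' \<in> B \<and> lev b \<le> lev b')" for x
    by (simp add: R_def block_triangular_ring_def)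
  have val: "\<zero>\<^bsub>R\<^esub> b b' = 0" "(x \<oplus>\<^bsub>R\<^esub> y) b b' = x b b' + y b b'"
    "(x \<otimes>\<^bsub>R\<^esub> y) b b' = (\<Sum>e\<in>B. x b e * y e b')" for b b' x y
    by (simp_all add: R_def block_triangular_ring_def)
  have one: "\<one>\<^bsub>R\<^esub> b e = (if b = e then 1 else 0)" for b
    using e by (auto simp: R_def block_triangular_ring_def)
  have L: "left_ideal ?L R"
  proof (rule left_idealI)
    fix a x assume a: "a \<in> carrier R" and x: "x \<in> ?L"
    have "(a \<otimes>\<^bsub>R\<^esub> x) b e = 0" if "lev b = lev e" for b
    proof (rule ccontr)
      assume "(a \<otimes>\<^bsub>R\<^esub> x) b e \<noteq> 0"
      then obtain e' where e': "a b e' \<noteq> 0" "x e' e \<noteq> 0"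
        unfolding val(3) by (rule nonzero_sum_mult)
      \<comment> \<open>The level of \<open>e'\<close> is squeezed between two equal levels, so the
        entry of \<open>x\<close> lies in the part of column \<open>e\<close> that vanishes.\<close>
      have "lev b \<le> lev e'" "lev e' \<le> lev e"
        using a x e' unfolding carrier by blast+
      then have "lev e' = lev e" using that by simp
      then show False using x e'(2) by simp
    qed
    then show "a \<otimes>\<^bsub>R\<^esub> x \<in> ?L" using a x by auto
  next
    show "\<zero>\<^bsub>R\<^esub> \<in> ?L" by (simp add: val(1))
    fix x y assume "x \<in> ?L" "y \<in> ?L"
    then show "x \<oplus>\<^bsub>R\<^esub> y \<in> ?L" by (simp add: val(2))
  qed auto
  have "J = carrier R" if J: "left_ideal J R" "?L \<subseteq> J" "J \<noteq> ?L" for J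
  proof -
    note JD = left_idealD[OF J(1)]
    obtain y where "y \<in> J" "y \<notin> ?L" using J by blast
    moreover from this have yc: "y \<in> carrier R" using JD(1) by blast
    ultimately obtain b where y: "y \<in> J" "lev b = lev e" "y b e \<noteq> 0" by blast
    have b: "b \<in> B" using y(3) yc unfolding carrier by blast
    \<comment> \<open>A multiple of the matrix unit in row \<open>e\<close> and column
      \<open>b\<close>, triangular because both levels agree. It makes column \<open>e\<close> of a
      y the unit column, so 1 - a y has zero column \<open>e\<close> and lies in
      \<open>?L\<close>.\<close>
    define a where "a = (\<lambda>c c'. if c = e \<and> c' = b then inverse (y b e) else 0)"
    have a: "a \<in> carrier R"
      using e b y(2) unfolding carrier a_def by simp
    have "(a \<otimes>\<^bsub>R\<^esub> y) c e = (if c = e then 1 else 0)" for c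
    proof -
      have "(a \<otimes>\<^bsub>R\<^esub> y) c e = (\<Sum>c'\<in>B. if c' = b then (if c = e then 1 else 0) else 0)"
        unfolding val(3) by (rule sum.cong) (simp_all add: a_def y(3))
      then show ?thesis using b B by simp
    qed
    moreover define z where "z = (\<lambda>c c'. \<one>\<^bsub>R\<^esub> c c' - (a \<otimes>\<^bsub>R\<^esub> y) c c')"
    ultimately have z: "z c e = 0" for c by (simp add: one)
    have ay: "a \<otimes>\<^bsub>R\<^esub> y \<in> carrier R" using a yc by simp
    have zc: "z \<in> carrier R"
      unfolding carrier
    proof (intro allI impI)
      fix c c' assume "z c c' \<noteq> 0"
      then have "\<one>\<^bsub>R\<^esub> c c' \<noteq> 0 \<or> (a \<otimes>\<^bsub>R\<^esub> y) c c' \<noteq> 0" by (auto simp: z_def)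
      then show "c \<in> B \<and> c' \<in> B \<and> lev c \<le> lev c'"
        using ay[unfolded carrier] one_closed[unfolded carrier] by blast
    qed
    have "(z \<oplus>\<^bsub>R\<^esub> a \<otimes>\<^bsub>R\<^esub> y) c c' = \<one>\<^bsub>R\<^esub> c c'" for c c'
      unfolding val(2) z_def by simp
    then have "z \<oplus>\<^bsub>R\<^esub> a \<otimes>\<^bsub>R\<^esub> y = \<one>\<^bsub>R\<^esub>" by (intro ext)
    moreover have "z \<in> J" using z zc J(2) by blast
    ultimately have "\<one>\<^bsub>R\<^esub> \<in> J" using JD(3)[OF _ JD(4)[OF a y(1)], of z] by simp
    then show ?thesis by (rule left_ideal_eq_carrier[OF J(1)])
  qed
  moreover have "\<one>\<^bsub>R\<^esub> \<notin> ?L" using one[of e] by auto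
  then have "?L \<noteq> carrier R" using one_closed by blast
  ultimately show ?thesis using L by (auto simp: maximal_left_ideal_def)
qed

text \<open>The maximal left ideals attached to the columns kill the diagonal blocks. Conversely, if
  \<open>x\<close> is strictly triangular then so is a x for every \<open>a\<close>, hence a x is
  nilpotent with an exponent that depends only on the levels.\<close>

lemma jacobson_radical_block_triangular_ring:
  fixes lev :: "'b \<Rightarrow> nat"
  assumes B: "finite B"
  shows "jacobson_radical (block_triangular_ring B lev :: ('b \<Rightarrow> 'b \<Rightarrow> 'k::field) ring)
    = strictly_block_triangular B lev" (is "jacobson_radical ?R = ?J")
proof
  interpret ring ?R by (rule ring_block_triangular_ring[OF B])
  show "jacobson_radical ?R \<subseteq> ?J"
  proof
    fix x assume x: "x \<in> jacobson_radical ?R"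
    then have xc: "x \<in> carrier ?R" by (simp add: jacobson_radical_def)
    have "lev b \<noteq> lev e" if "x b e \<noteq> 0" for b e
    proof
      assume lev: "lev b = lev e"
      have "e \<in> B" using xc that by (simp add: block_triangular_ring_def)
      then have "x \<in> {x \<in> carrier ?R. \<forall>b. lev b = lev e \<longrightarrow> x b e = 0}"
        using x maximal_left_ideal_block_column[OF B] unfolding jacobson_radical_def by blast
      with lev that show False by simp
    qed
    then show "x \<in> ?J"
      using xc by (auto simp: strictly_block_triangular_def block_triangular_ring_def order_less_le)
  qed
  obtain N where N: "\<And>b. b \<in> B \<Longrightarrow> lev b < N"
    using B finite_nat_set_iff_bounded[of "lev ` B"] by auto
  show "?J \<subseteq> jacobson_radical ?R"
  proof
    fix x assume x: "x \<in> ?J"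
    then have xc: "x \<in> carrier ?R"
      by (auto simp: strictly_block_triangular_def block_triangular_ring_def order_less_le)
    have "(a \<otimes>\<^bsub>?R\<^esub> x) [^]\<^bsub>?R\<^esub> N = \<zero>\<^bsub>?R\<^esub>" if a: "a \<in> carrier ?R" for a
    proof -
      have ax: "b \<in> B \<and> b' \<in> B \<and> lev b < lev b'" if "(a \<otimes>\<^bsub>?R\<^esub> x) b b' \<noteq> 0" for b b'
      proof -
        from that obtain e where "a b e \<noteq> 0" "x e b' \<noteq> 0"
          by (auto simp: block_triangular_ring_def elim: nonzero_sum_mult)
        then have "b \<in> B" "lev b \<le> lev e" "b' \<in> B" "lev e < lev b'"
          using a x by (auto simp: strictly_block_triangular_def block_triangular_ring_def)
        then show ?thesis by simp
      qed
      \<comment> \<open>Every factor raises the level by at least one, so a nonzero entry of the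
        power \<open>N\<close> would end at level \<open>N\<close> or higher, beyond the
        bound.\<close>
      have pow: "b \<in> B \<and> b' \<in> B \<and> lev b + k \<le> lev b'"
        if "((a \<otimes>\<^bsub>?R\<^esub> x) [^]\<^bsub>?R\<^esub> k) b b' \<noteq> 0" for k :: nat and b b'
        using that
      proof (induction k arbitrary: b')
        case 0
        then show ?case by (auto simp: block_triangular_ring_def split: if_splits)
      next
        case (Suc k)
        let ?z = "a \<otimes>\<^bsub>?R\<^esub> x"
        have "(\<Sum>e\<in>B. (?z [^]\<^bsub>?R\<^esub> k) b e * ?z e b') \<noteq> 0"
          using Suc.prems by (simp add: block_triangular_ring_def)
        then obtain e where e: "(?z [^]\<^bsub>?R\<^esub> k) b e \<noteq> 0" "?z e b' \<noteq> 0"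
          by (rule nonzero_sum_mult)
        show ?case using Suc.IH[OF e(1)] ax[OF e(2)] by simp
      qed
      show ?thesis
      proof (intro ext)
        fix b b'
        show "((a \<otimes>\<^bsub>?R\<^esub> x) [^]\<^bsub>?R\<^esub> N) b b' = \<zero>\<^bsub>?R\<^esub> b b'"
        proof (rule ccontr)
          assume "\<not> ?thesis"
          then have "((a \<otimes>\<^bsub>?R\<^esub> x) [^]\<^bsub>?R\<^esub> N) b b' \<noteq> 0" by (simp add: block_triangular_ring_def)
          from pow[OF this] N[of b'] show False by simp
        qed
      qed
    qed
    then show "x \<in> jacobson_radical ?R"
      using mem_maximal_left_ideal_of_nilpotent[OF _ xc] xc by (auto simp: jacobson_radical_def)
  qed
qed

section \<open>Endomorphisms of projectives as block triangular matrices\<close>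

abbreviation linear_path :: "nat \<Rightarrow> nat \<Rightarrow> (nat \<times> nat) list" where
  "linear_path i v \<equiv> map (\<lambda>k. (k, Suc k)) [i..<v]"

lemma Cons_eq_linear_path_iff:
  "e # p = linear_path i v \<longleftrightarrow> i < v \<and> e = (i, Suc i) \<and> p = linear_path (Suc i) v"
  by (cases "i < v") (auto simp: upt_conv_Cons)

lemma verts_linear_quiver_3 [simp]: "verts linear_quiver_3 = {1, 2, 3}"
  by (simp add: linear_quiver_3_def)

lemma mem_arcs_linear_quiver_3: "a \<in> arcs linear_quiver_3 \<longleftrightarrow> (\<exists>v\<in>{1, 2}. a = (v, Suc v))"
  by (auto simp: linear_quiver_3_def)

lemma tail_head_linear_quiver_3 [simp]: "tail linear_quiver_3 = fst" "head linear_quiver_3 = snd"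
  by (simp_all add: linear_quiver_3_def)

text \<open>A nonempty walk from \<open>i\<close> must begin with the arrow to \<open>Suc i\<close>,
  so the endpoints determine it. The condition i \<le> v excludes v < i, where
  \<open>linear_path i v\<close> is empty although no walk exists.\<close>

lemma awalk_linear_quiver_3:
  "pre_digraph.awalk linear_quiver_3 i p v \<longleftrightarrow>
    i \<in> {1, 2, 3} \<and> v \<in> {1, 2, 3} \<and> i \<le> v \<and> p = linear_path i v"
proof -
  interpret wf_digraph linear_quiver_3 by (rule wf_digraph_linear_quiver_3)
  show ?thesis
  proof (induction p arbitrary: i)
    case Nil
    then show ?case by (auto simp: awalk_Nil_iff)
  next
    case (Cons e p)
    have "awalk i (e # p) v \<longleftrightarrow> (i \<in> {1, 2} \<and> e = (i, Suc i)) \<and> awalk (Suc i) p v"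
      unfolding awalk_Cons_iff mem_arcs_linear_quiver_3 by auto
    moreover have "i \<in> {1, 2} \<and> Suc i \<in> {1, 2, 3} \<and> Suc i \<le> v \<longleftrightarrow> i \<in> {1, 2, 3} \<and> i < v" if "v \<in> {1, 2, 3}"
      using that by auto
    ultimately show ?case
      unfolding Cons.IH Cons_eq_linear_path_iff by (blast intro: less_imp_le)
  qed
qed

section \<open>Coordinates on the sum of projectives\<close>

definition projective_basis :: "(nat \<Rightarrow> nat) \<Rightarrow> (nat \<times> nat) set" where
  "projective_basis D = (SIGMA i:{1, 2, 3}. {..<D i})"

lemma finite_projective_basis [simp]: "finite (projective_basis D)"
  by (simp add: projective_basis_def)

lemma fst_projective_basis: "b \<in> projective_basis D \<Longrightarrow> fst b \<in> {1, 2, 3}"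
  by (auto simp: projective_basis_def)

abbreviation linear_projective ::
  "(nat \<Rightarrow> nat) \<Rightarrow> (nat, nat \<times> nat, 'k::field, nat \<times> nat \<Rightarrow> (nat \<times> nat) list \<Rightarrow> 'k) quiver_rep" where
  "linear_projective D \<equiv> projective_sum_rep linear_quiver_3 D"

lemma linear_projective_eq:
  "linear_projective D = direct_sum_rep (projective_basis D) (\<lambda>b. projective_rep linear_quiver_3 (fst b))"
  unfolding projective_sum_rep_def projective_basis_def verts_linear_quiver_3 case_prod_beta' ..

text \<open>A summand has at most one path ending in \<open>v\<close>, so an element amounts to one
  scalar for each summand starting at or before \<open>v\<close>; the finiteness conditions follow
  from this finite support.\<close>

lemma mem_space_linear_projective:
  assumes v: "v \<in> {1, 2, 3}"
  shows "x \<in> rep_space (linear_projective D :: (_, _, 'k::field, _) quiver_rep) v \<longleftrightarrow>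
    (\<forall>b p. x b p \<noteq> 0 \<longrightarrow> b \<in> projective_basis D \<and> fst b \<le> v \<and> p = linear_path (fst b) v)"
    (is "_ \<longleftrightarrow> ?R")
proof -
  have "x \<in> rep_space (linear_projective D :: (_, _, 'k, _) quiver_rep) v \<longleftrightarrow>
    finite {b. x b \<noteq> 0} \<and> (\<forall>b\<in>projective_basis D. finite {p. x b p \<noteq> 0} \<and>
      (\<forall>p. x b p \<noteq> 0 \<longrightarrow> fst b \<le> v \<and> p = linear_path (fst b) v)) \<and> (\<forall>b. b \<notin> projective_basis D \<longrightarrow> x b = 0)"
    (is "_ \<longleftrightarrow> ?L")
    using v fst_projective_basis[of _ D]
    by (auto simp: linear_projective_eq direct_sum_rep_def projective_rep_def subset_iff awalk_linear_quiver_3)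
  also have "?L \<longleftrightarrow> ?R"
  proof
    assume L: ?L
    show ?R
    proof (intro allI impI)
      fix b p assume x: "x b p \<noteq> 0"
      then have "b \<in> projective_basis D" using L by (metis zero_fun_def)
      with L x show "b \<in> projective_basis D \<and> fst b \<le> v \<and> p = linear_path (fst b) v" by simp
    qed
  next
    assume R: ?R
    have "{b. x b \<noteq> 0} \<subseteq> projective_basis D" using R by (force simp: fun_eq_iff)
    then have "finite {b. x b \<noteq> 0}" by (rule finite_subset) simp
    moreover have "finite {p. x b p \<noteq> 0}" for b
    proof (rule finite_subset)
      show "{p. x b p \<noteq> 0} \<subseteq> {linear_path (fst b) v}" using R by blast
    qed simp
    moreover have "x b = 0" if "b \<notin> projective_basis D" for b
    proof
      show "x b p = 0 p" for p using R that unfolding zero_fun_apply by blast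
    qed
    ultimately show ?L using R by blast
  qed
  finally show ?thesis .
qed

definition coord :: "nat \<Rightarrow> (nat \<times> nat \<Rightarrow> (nat \<times> nat) list \<Rightarrow> 'k) \<Rightarrow> nat \<times> nat \<Rightarrow> 'k" where
  "coord v x b = x b (linear_path (fst b) v)"

text \<open>Inverse of \<open>coord\<close>. Coordinates of summands starting after \<open>v\<close>
  are discarded, as these have no path to \<open>v\<close>.\<close>

definition of_coord ::
  "(nat \<Rightarrow> nat) \<Rightarrow> nat \<Rightarrow> (nat \<times> nat \<Rightarrow> 'k::field) \<Rightarrow> nat \<times> nat \<Rightarrow> (nat \<times> nat) list \<Rightarrow> 'k" where
  "of_coord D v f b p =
    (if b \<in> projective_basis D \<and> fst b \<le> v \<and> p = linear_path (fst b) v then f b else 0)"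

lemma of_coord_mem: "v \<in> {1, 2, 3} \<Longrightarrow> of_coord D v f \<in> rep_space (linear_projective D) v"
  by (simp add: mem_space_linear_projective of_coord_def)

lemma coord_of_coord: "coord v (of_coord D v f) b = (if b \<in> projective_basis D \<and> fst b \<le> v then f b else 0)"
  by (simp add: coord_def of_coord_def)

lemma coord_eq_0:
  assumes "v \<in> {1, 2, 3}" "x \<in> rep_space (linear_projective D :: (_, _, 'k::field, _) quiver_rep) v"
    "\<not> (b \<in> projective_basis D \<and> fst b \<le> v)"
  shows "coord v x b = 0"
  using assms unfolding mem_space_linear_projective[OF assms(1)] coord_def by blast

lemma of_coord_coord:
  assumes "v \<in> {1, 2, 3}" "x \<in> rep_space (linear_projective D :: (_, _, 'k::field, _) quiver_rep) v"
  shows "of_coord D v (coord v x) = x"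
proof (intro ext)
  fix b p
  show "of_coord D v (coord v x) b p = x b p"
    using assms(2)[unfolded mem_space_linear_projective[OF assms(1)], rule_format, of b p]
    by (auto simp: of_coord_def coord_def)
qed

lemma coord_eqI:
  assumes "v \<in> {1, 2, 3}" "x \<in> rep_space (linear_projective D :: (_, _, 'k::field, _) quiver_rep) v"
    "y \<in> rep_space (linear_projective D :: (_, _, 'k::field, _) quiver_rep) v"
    "\<And>b. coord v x b = coord v y b"
  shows "x = y"
proof -
  have "coord v x = coord v y" using assms(4) by (intro ext)
  then have "of_coord D v (coord v x) = of_coord D v (coord v y)" by (rule arg_cong)
  then show ?thesis unfolding of_coord_coord[OF assms(1,2)] of_coord_coord[OF assms(1,3)] .
qed

lemma coord_add: "coord v (x + y) b = coord v x b + (coord v y b :: 'k::field)"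
  by (simp add: coord_def)

lemma coord_scale:
  assumes "v \<in> {1, 2, 3}" "x \<in> rep_space (linear_projective D :: (_, _, 'k::field, _) quiver_rep) v"
  shows "coord v (rep_scale (linear_projective D) c x) b = c * coord v x b"
proof (cases "b \<in> projective_basis D")
  case True
  then show ?thesis
    by (simp add: coord_def linear_projective_eq direct_sum_rep_def projective_rep_def)
next
  case False
  then show ?thesis
    using coord_eq_0[OF assms, of b]
    by (simp add: coord_def linear_projective_eq direct_sum_rep_def projective_rep_def)
qed

text \<open>An arrow extends the unique path by one step and keeps its coefficient. This is why the
  matrix of a morphism is the same at all vertices.\<close>

lemma coord_map:
  assumes v: "v \<in> {1, 2}" and x: "x \<in> rep_space (linear_projective D :: (_, _, 'k::field, _) quiver_rep) v"
  shows "coord (Suc v) (rep_map (linear_projective D) (v, Suc v) x) b = coord v x b"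
proof (cases "b \<in> projective_basis D \<and> fst b \<le> v")
  case True
  then show ?thesis
    by (simp add: coord_def linear_projective_eq direct_sum_rep_def projective_rep_def)
next
  case False
  \<comment> \<open>For a summand starting after \<open>v\<close> both sides are 0: the left one is
    a coefficient at the empty path, which occurs in no image of an arrow.\<close>
  moreover have "\<not> fst b \<le> v \<Longrightarrow> linear_path (fst b) (Suc v) = []" by simp
  ultimately show ?thesis
    using coord_eq_0[of v x D b] v x
    by (auto simp: coord_def linear_projective_eq direct_sum_rep_def projective_rep_def)
qed

section \<open>Morphisms and their matrices\<close>

lemma rep_hom_eqI:
  assumes "\<phi> \<in> rep_hom Q M N" "\<psi> \<in> rep_hom Q M N"
    and "\<And>v x. v \<in> verts Q \<Longrightarrow> x \<in> rep_space M v \<Longrightarrow> \<phi> v x = \<psi> v x"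
  shows "\<phi> = \<psi>"
proof (intro ext)
  fix v x
  have "\<phi> \<in> (\<Pi>\<^sub>E v\<in>verts Q. rep_space M v \<rightarrow>\<^sub>E rep_space N v)"
    "\<psi> \<in> (\<Pi>\<^sub>E v\<in>verts Q. rep_space M v \<rightarrow>\<^sub>E rep_space N v)"
    using assms(1,2) by (simp_all add: rep_hom_def)
  then show "\<phi> v x = \<psi> v x"
    using assms(3)[of v x]
    by (cases "v \<in> verts Q"; cases "x \<in> rep_space M v") (simp_all add: PiE_iff extensional_def)
qed

text \<open>Columns belong to source summands and rows to target summands, so composition becomes
  the matrix product in the same order. An entry in row \<open>b\<close> and column \<open>e\<close>
  stands for a multiple of the path from \<open>fst b\<close> to \<open>fst e\<close>.\<close>

definition matrix_hom :: "(nat \<Rightarrow> nat) \<Rightarrow> (nat \<times> nat \<Rightarrow> nat \<times> nat \<Rightarrow> 'k::field) \<Rightarrow>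
    nat \<Rightarrow> (nat \<times> nat \<Rightarrow> (nat \<times> nat) list \<Rightarrow> 'k) \<Rightarrow> nat \<times> nat \<Rightarrow> (nat \<times> nat) list \<Rightarrow> 'k" where
  "matrix_hom D c = (\<lambda>v\<in>{1, 2, 3}. \<lambda>x\<in>rep_space (linear_projective D :: (_, _, 'k, _) quiver_rep) v.
     of_coord D v (\<lambda>b. \<Sum>e\<in>projective_basis D. c b e * coord v x e))"

abbreviation projective_matrices :: "(nat \<Rightarrow> nat) \<Rightarrow> (nat \<times> nat \<Rightarrow> nat \<times> nat \<Rightarrow> 'k::field) ring" where
  "projective_matrices D \<equiv> block_triangular_ring (projective_basis D) fst"

lemma mem_projective_matrices:
  "c \<in> carrier (projective_matrices D) \<longleftrightarrow>
    (\<forall>b b'. c b b' \<noteq> 0 \<longrightarrow> b \<in> projective_basis D \<and> b' \<in> projective_basis D \<and> fst b \<le> fst b')"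
  by (simp add: block_triangular_ring_def)

lemma quiver_representation_linear_projective:
  "quiver_representation linear_quiver_3 (linear_projective D :: (_, _, 'k::field, _) quiver_rep)"
  by (rule quiver_representation_projective_sum_rep[OF wf_digraph_linear_quiver_3])

lemma matrix_hom_mem:
  assumes "v \<in> {1, 2, 3}" "x \<in> rep_space (linear_projective D :: (_, _, 'k::field, _) quiver_rep) v"
  shows "matrix_hom D c v x \<in> rep_space (linear_projective D :: (_, _, 'k, _) quiver_rep) v"
proof -
  have "matrix_hom D c v x = of_coord D v (\<lambda>b. \<Sum>e\<in>projective_basis D. c b e * coord v x e)"
    using assms by (simp add: matrix_hom_def)
  then show ?thesis using of_coord_mem[OF assms(1)] by simp
qed

text \<open>The truncation in \<open>of_coord\<close> loses nothing: a nonzero term of the sum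
  forces fst b \<le> fst e \<le> v.\<close>

lemma coord_matrix_hom:
  assumes c: "c \<in> carrier (projective_matrices D)"
    and v: "v \<in> {1, 2, 3}" and x: "x \<in> rep_space (linear_projective D :: (_, _, 'k::field, _) quiver_rep) v"
  shows "coord v (matrix_hom D c v x) b = (\<Sum>e\<in>projective_basis D. c b e * coord v x e)"
proof -
  have "c b e * coord v x e = 0" if "\<not> (b \<in> projective_basis D \<and> fst b \<le> v)" for e
  proof (rule ccontr)
    assume "c b e * coord v x e \<noteq> 0"
    then have "c b e \<noteq> 0" "coord v x e \<noteq> 0" by auto
    moreover from this have "fst e \<le> v" using coord_eq_0[OF v x, of e] by blast
    ultimately show False
      using that c[unfolded mem_projective_matrices, rule_format, of b e] by simp
  qed
  moreover have "matrix_hom D c v x = of_coord D v (\<lambda>b. \<Sum>e\<in>projective_basis D. c b e * coord v x e)"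
    using v x by (simp add: matrix_hom_def)
  ultimately show ?thesis by (simp add: coord_of_coord sum.neutral)
qed

lemma matrix_hom_mem_rep_hom:
  assumes c: "c \<in> carrier (projective_matrices D :: (_ \<Rightarrow> _ \<Rightarrow> 'k::field) ring)"
  shows "matrix_hom D c \<in> rep_hom linear_quiver_3 (linear_projective D) (linear_projective D)"
proof -
  let ?P = "linear_projective D :: (_, _, 'k, _) quiver_rep" and ?h = "matrix_hom D c"
  interpret P: quiver_representation linear_quiver_3 ?P
    by (rule quiver_representation_linear_projective)
  have PiE: "?h \<in> (\<Pi>\<^sub>E v\<in>{1, 2, 3}. rep_space ?P v \<rightarrow>\<^sub>E rep_space ?P v)"
    using matrix_hom_mem[of _ _ D c] by (auto simp: matrix_hom_def PiE_iff)
  have add: "?h v (x + y) = ?h v x + ?h v y"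
    if v: "v \<in> {1, 2, 3}" and x: "x \<in> rep_space ?P v" and y: "y \<in> rep_space ?P v" for v x y
  proof (rule coord_eqI[OF v])
    have xy: "x + y \<in> rep_space ?P v" using P.add_closed[of v] v x y by simp
    then show "?h v (x + y) \<in> rep_space ?P v" by (rule matrix_hom_mem[OF v])
    show "?h v x + ?h v y \<in> rep_space ?P v"
      using P.add_closed[OF _ matrix_hom_mem[OF v x] matrix_hom_mem[OF v y]] v by simp
    fix b show "coord v (?h v (x + y)) b = coord v (?h v x + ?h v y) b"
      unfolding coord_add coord_matrix_hom[OF c v xy] coord_matrix_hom[OF c v x] coord_matrix_hom[OF c v y]
        distrib_left sum.distrib ..
  qed
  have scale: "?h v (rep_scale ?P t x) = rep_scale ?P t (?h v x)"
    if v: "v \<in> {1, 2, 3}" and x: "x \<in> rep_space ?P v" for v t x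
  proof (rule coord_eqI[OF v])
    have tx: "rep_scale ?P t x \<in> rep_space ?P v" using P.scale_closed[of v] v x by simp
    then show "?h v (rep_scale ?P t x) \<in> rep_space ?P v" by (rule matrix_hom_mem[OF v])
    show "rep_scale ?P t (?h v x) \<in> rep_space ?P v"
      using P.scale_closed[OF _ matrix_hom_mem[OF v x]] v by simp
    fix b show "coord v (?h v (rep_scale ?P t x)) b = coord v (rep_scale ?P t (?h v x)) b"
      unfolding coord_scale[OF v matrix_hom_mem[OF v x]] coord_matrix_hom[OF c v tx]
        coord_matrix_hom[OF c v x] coord_scale[OF v x] sum_distrib_left by (simp only: mult.left_commute)
  qed
  have map: "?h (Suc v) (rep_map ?P (v, Suc v) x) = rep_map ?P (v, Suc v) (?h v x)"
    if v: "v \<in> {1, 2}" and x: "x \<in> rep_space ?P v" for v x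
  proof -
    have v3: "v \<in> {1, 2, 3}" "Suc v \<in> {1, 2, 3}" and a: "(v, Suc v) \<in> arcs linear_quiver_3"
      using v by (auto simp: mem_arcs_linear_quiver_3)
    have mx: "rep_map ?P (v, Suc v) x \<in> rep_space ?P (Suc v)" if "x \<in> rep_space ?P v" for x
      using P.map_closed[OF a] that by simp
    show ?thesis
    proof (rule coord_eqI[OF v3(2)])
      show "?h (Suc v) (rep_map ?P (v, Suc v) x) \<in> rep_space ?P (Suc v)"
        by (rule matrix_hom_mem[OF v3(2) mx[OF x]])
      show "rep_map ?P (v, Suc v) (?h v x) \<in> rep_space ?P (Suc v)"
        by (rule mx[OF matrix_hom_mem[OF v3(1) x]])
      fix b show "coord (Suc v) (?h (Suc v) (rep_map ?P (v, Suc v) x)) b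
          = coord (Suc v) (rep_map ?P (v, Suc v) (?h v x)) b"
        unfolding coord_matrix_hom[OF c v3(2) mx[OF x]] coord_map[OF v matrix_hom_mem[OF v3(1) x]]
          coord_map[OF v x] coord_matrix_hom[OF c v3(1) x] ..
    qed
  qed
  have arcs: "\<forall>a\<in>arcs linear_quiver_3. \<forall>x\<in>rep_space ?P (fst a). ?h (snd a) (rep_map ?P a x) = rep_map ?P a (?h (fst a) x)"
  proof (intro ballI)
    fix a x assume "a \<in> arcs linear_quiver_3" and x: "x \<in> rep_space ?P (fst a)"
    then obtain v where "v \<in> {1, 2}" "a = (v, Suc v)" unfolding mem_arcs_linear_quiver_3 by blast
    with map x show "?h (snd a) (rep_map ?P a x) = rep_map ?P a (?h (fst a) x)" by simp
  qed
  show ?thesis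
    unfolding rep_hom_def mem_Collect_eq verts_linear_quiver_3 tail_head_linear_quiver_3
    by (intro conjI ballI allI PiE add scale arcs)
qed

abbreviation unit_coord :: "nat \<times> nat \<Rightarrow> nat \<times> nat \<Rightarrow> 'k::field" where
  "unit_coord b \<equiv> \<lambda>e. if e = b then 1 else 0"

text \<open>At v = fst e the unit vector is the constant path, which generates the summand
  \<open>e\<close>; its image recovers column \<open>e\<close>, whence injectivity.\<close>

lemma coord_matrix_hom_unit:
  fixes c :: "nat \<times> nat \<Rightarrow> nat \<times> nat \<Rightarrow> 'k::field"
  assumes c: "c \<in> carrier (projective_matrices D)"
    and v: "v \<in> {1, 2, 3}" and e: "e \<in> projective_basis D" "fst e \<le> v"
  shows "coord v (matrix_hom D c v (of_coord D v (unit_coord e))) b = c b e"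
proof -
  have "coord v (matrix_hom D c v (of_coord D v (unit_coord e))) b =
      (\<Sum>e'\<in>projective_basis D. if e' = e then c b e else 0)"
    unfolding coord_matrix_hom[OF c v of_coord_mem[OF v]] coord_of_coord
    by (rule sum.cong) (use e in auto)
  then show ?thesis using e by simp
qed

lemma inj_on_matrix_hom:
  "inj_on (matrix_hom D) (carrier (projective_matrices D :: (_ \<Rightarrow> _ \<Rightarrow> 'k::field) ring))"
proof (intro inj_onI ext)
  fix c c' :: "nat \<times> nat \<Rightarrow> nat \<times> nat \<Rightarrow> 'k" and b e
  assume cc: "c \<in> carrier (projective_matrices D)" "c' \<in> carrier (projective_matrices D)"
    and eq: "matrix_hom D c = matrix_hom D c'"
  show "c b e = c' b e"
  proof (cases "e \<in> projective_basis D")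
    case True
    then show ?thesis
      using coord_matrix_hom_unit[OF cc(1) fst_projective_basis[OF True] True order_refl, of b]
        coord_matrix_hom_unit[OF cc(2) fst_projective_basis[OF True] True order_refl, of b] eq by simp
  next
    case False
    then show ?thesis
      using cc[unfolded mem_projective_matrices] by metis
  qed
qed

lemma rep_hom_linear_projectiveD:
  assumes "\<phi> \<in> rep_hom linear_quiver_3 (linear_projective D :: (_, _, 'k::field, _) quiver_rep) (linear_projective D)"
    and v: "v \<in> {1, 2, 3}" and x: "x \<in> rep_space (linear_projective D :: (_, _, 'k, _) quiver_rep) v"
  shows "\<phi> v x \<in> rep_space (linear_projective D :: (_, _, 'k, _) quiver_rep) v"
    and "y \<in> rep_space (linear_projective D :: (_, _, 'k, _) quiver_rep) v \<Longrightarrow> \<phi> v (x + y) = \<phi> v x + \<phi> v y"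
    and "\<phi> v (rep_scale (linear_projective D) t x) = rep_scale (linear_projective D) t (\<phi> v x)"
    and "v \<in> {1, 2} \<Longrightarrow> \<phi> (Suc v) (rep_map (linear_projective D) (v, Suc v) x) = rep_map (linear_projective D) (v, Suc v) (\<phi> v x)"
proof -
  let ?P = "linear_projective D :: (_, _, 'k, _) quiver_rep"
  have \<phi>: "\<phi> \<in> (\<Pi>\<^sub>E v\<in>{1, 2, 3}. rep_space ?P v \<rightarrow>\<^sub>E rep_space ?P v)"
    "\<forall>v\<in>{1, 2, 3}. \<forall>x\<in>rep_space ?P v. \<forall>y\<in>rep_space ?P v. \<phi> v (x + y) = \<phi> v x + \<phi> v y"
    "\<forall>v\<in>{1, 2, 3}. \<forall>c. \<forall>x\<in>rep_space ?P v. \<phi> v (rep_scale ?P c x) = rep_scale ?P c (\<phi> v x)"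
    "\<forall>a\<in>arcs linear_quiver_3. \<forall>x\<in>rep_space ?P (fst a). \<phi> (snd a) (rep_map ?P a x) = rep_map ?P a (\<phi> (fst a) x)"
    using assms(1) unfolding rep_hom_def mem_Collect_eq verts_linear_quiver_3 tail_head_linear_quiver_3
    by blast+
  show "\<phi> v x \<in> rep_space ?P v"
    by (rule PiE_mem[OF PiE_mem[OF \<phi>(1) v] x])
  show "\<phi> v (x + y) = \<phi> v x + \<phi> v y" if "y \<in> rep_space ?P v"
    using \<phi>(2) v x that by blast
  show "\<phi> v (rep_scale ?P t x) = rep_scale ?P t (\<phi> v x)"
    using \<phi>(3) v x by blast
  show "\<phi> (Suc v) (rep_map ?P (v, Suc v) x) = rep_map ?P (v, Suc v) (\<phi> v x)" if "v \<in> {1, 2}"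
  proof -
    have "(v, Suc v) \<in> arcs linear_quiver_3" unfolding mem_arcs_linear_quiver_3 using that by blast
    from bspec[OF \<phi>(4) this] x show ?thesis by simp
  qed
qed

text \<open>The Yoneda argument for projectives: a morphism is determined by the images of the
  generators, which become the columns of \<open>c\<close>. Arrows carry these images to later
  vertices (\<open>unit\<close>), and linearity extends them to all vectors
  (\<open>lin\<close>).\<close>

lemma matrix_hom_surj:
  assumes \<phi>: "\<phi> \<in> rep_hom linear_quiver_3 (linear_projective D :: (_, _, 'k::field, _) quiver_rep) (linear_projective D)"
  shows "\<phi> \<in> matrix_hom D ` carrier (projective_matrices D)"
proof -
  let ?P = "linear_projective D :: (_, _, 'k, _) quiver_rep" and ?B = "projective_basis D"
  interpret P: quiver_representation linear_quiver_3 ?P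
    by (rule quiver_representation_linear_projective)
  note hom = rep_hom_linear_projectiveD[OF \<phi>]
  \<comment> \<open>Column \<open>e\<close> is the image of the constant path of summand
    \<open>e\<close>. Off the index set, where \<open>fst e\<close> need not be a vertex, it is 0 so
    that \<open>c\<close> lies in the carrier.\<close>
  define c where "c b e = (if e \<in> ?B then coord (fst e) (\<phi> (fst e) (of_coord D (fst e) (unit_coord e))) b else 0)" for b e
  have c: "c \<in> carrier (projective_matrices D)"
    unfolding mem_projective_matrices
  proof (intro allI impI)
    fix b e assume ce: "c b e \<noteq> 0"
    then have e: "e \<in> ?B" by (simp add: c_def split: if_splits)
    note v = fst_projective_basis[OF e]
    have "coord (fst e) (\<phi> (fst e) (of_coord D (fst e) (unit_coord e))) b \<noteq> 0"
      using ce e by (simp add: c_def)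
    then show "b \<in> ?B \<and> e \<in> ?B \<and> fst b \<le> fst e"
      using coord_eq_0[OF v hom(1)[OF v of_coord_mem[OF v]]] e by blast
  qed
  have unit: "coord v (\<phi> v (of_coord D v (unit_coord e))) b = c b e"
    if e: "e \<in> ?B" and v: "fst e \<le> v" "v \<le> 3" for e v b
    using v
  proof (induction v rule: dec_induct)
    case base
    then show ?case using e by (simp add: c_def)
  next
    case (step v)
    have v: "v \<in> {1, 2}" "v \<in> {1, 2, 3}" "Suc v \<in> {1, 2, 3}"
      using step fst_projective_basis[OF e] by auto
    have a: "(v, Suc v) \<in> arcs linear_quiver_3" using v(1) by (auto simp: mem_arcs_linear_quiver_3)
    let ?u = "of_coord D v (unit_coord e) :: _ \<Rightarrow> _ \<Rightarrow> 'k"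
    note u = of_coord_mem[OF v(2), of D "unit_coord e :: _ \<Rightarrow> 'k"]
    \<comment> \<open>The unit vector at \<open>Suc v\<close> is the image of the one at
      \<open>v\<close> under an arrow, and the morphism commutes with arrows.\<close>
    have "of_coord D (Suc v) (unit_coord e) = rep_map ?P (v, Suc v) ?u"
    proof (rule coord_eqI[OF v(3) of_coord_mem[OF v(3)]])
      show "rep_map ?P (v, Suc v) ?u \<in> rep_space ?P (Suc v)"
        using P.map_closed[OF a] u by simp
      fix b' show "coord (Suc v) (of_coord D (Suc v) (unit_coord e)) b' = coord (Suc v) (rep_map ?P (v, Suc v) ?u) b'"
        unfolding coord_map[OF v(1) u] coord_of_coord using e step by auto
    qed
    then show ?case
      using hom(4)[OF v(2) u v(1)] coord_map[OF v(1) hom(1)[OF v(2) u], of b] step by simp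
  qed
  \<comment> \<open>Morphisms are additive in two arguments, so the support is built up one summand
    at a time.\<close>
  have lin: "coord v (\<phi> v (of_coord D v (\<lambda>e. if e \<in> A then f e else 0))) b = (\<Sum>e\<in>A. c b e * f e)"
    if v: "v \<in> {1, 2, 3}" and A: "finite A" "A \<subseteq> {e \<in> ?B. fst e \<le> v}" for v A f b
    using A
  proof (induction A rule: finite_induct)
    case empty
    let ?z = "of_coord D v (\<lambda>e. 0) :: _ \<Rightarrow> _ \<Rightarrow> 'k"
    note z = of_coord_mem[OF v, of D "\<lambda>_. 0 :: 'k"]
    \<comment> \<open>The zero vector is 0 times itself, so homogeneity makes its image
      zero.\<close>
    have "rep_scale ?P 0 ?z = ?z"
    proof (rule coord_eqI[OF v _ z])
      show "rep_scale ?P 0 ?z \<in> rep_space ?P v" using P.scale_closed[of v] v z by simp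
    qed (simp add: coord_scale[OF v z] coord_of_coord)
    then have "coord v (\<phi> v ?z) b = 0"
      using hom(3)[OF v z, of 0] coord_scale[OF v hom(1)[OF v z], of 0 b] by simp
    then show ?case by simp
  next
    case (insert e A)
    let ?u = "of_coord D v (unit_coord e) :: _ \<Rightarrow> _ \<Rightarrow> 'k"
    let ?w = "of_coord D v (\<lambda>e. if e \<in> A then f e else 0)"
    note u = of_coord_mem[OF v, of D "unit_coord e :: _ \<Rightarrow> 'k"]
    note w = of_coord_mem[OF v, of D "\<lambda>e. if e \<in> A then f e else 0"]
    have su: "rep_scale ?P (f e) ?u \<in> rep_space ?P v"
      using P.scale_closed[of v] v u by simp
    have "of_coord D v (\<lambda>e'. if e' \<in> insert e A then f e' else 0) = rep_scale ?P (f e) ?u + ?w"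
    proof (rule coord_eqI[OF v of_coord_mem[OF v]])
      show "rep_scale ?P (f e) ?u + ?w \<in> rep_space ?P v"
        using P.add_closed[of v] v su w by simp
      fix b'
      show "coord v (of_coord D v (\<lambda>e'. if e' \<in> insert e A then f e' else 0)) b' =
          coord v (rep_scale ?P (f e) ?u + ?w) b'"
        unfolding coord_add coord_scale[OF v u] coord_of_coord using insert.hyps by auto
    qed
    then have "coord v (\<phi> v (of_coord D v (\<lambda>e'. if e' \<in> insert e A then f e' else 0))) b =
        f e * coord v (\<phi> v ?u) b + coord v (\<phi> v ?w) b"
      using hom(2)[OF v su w] hom(3)[OF v u, of "f e"] by (simp add: coord_add coord_scale[OF v hom(1)[OF v u]])
    then show ?case using insert unit[of e v b] v by auto
  qed
  have "matrix_hom D c = \<phi>"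
  proof (rule rep_hom_eqI[OF matrix_hom_mem_rep_hom[OF c] \<phi>])
    fix v x assume "v \<in> verts linear_quiver_3" and x: "x \<in> rep_space ?P v"
    then have v: "v \<in> {1, 2, 3}" by simp
    let ?A = "{e \<in> ?B. fst e \<le> v}"
    show "matrix_hom D c v x = \<phi> v x"
    proof (rule coord_eqI[OF v matrix_hom_mem[OF v x] hom(1)[OF v x]])
      fix b
      have "(\<lambda>e. if e \<in> ?A then coord v x e else 0) = coord v x"
        using coord_eq_0[OF v x] by (auto simp: fun_eq_iff)
      then have "coord v (\<phi> v x) b = (\<Sum>e\<in>?A. c b e * coord v x e)"
        using lin[OF v, of ?A "coord v x" b] of_coord_coord[OF v x] by simp
      also have "\<dots> = (\<Sum>e\<in>?B. c b e * coord v x e)"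
      proof (rule sum.mono_neutral_left)
        show "\<forall>e\<in>?B - ?A. c b e * coord v x e = 0"
          using coord_eq_0[OF v x] by simp
      qed auto
      finally show "coord v (matrix_hom D c v x) b = coord v (\<phi> v x) b"
        by (simp add: coord_matrix_hom[OF c v x])
    qed
  qed
  with c show ?thesis by blast
qed

lemma matrix_hom_ring_iso:
  "matrix_hom D \<in> ring_iso (projective_matrices D :: (_ \<Rightarrow> _ \<Rightarrow> 'k::field) ring)
    (rep_end linear_quiver_3 (linear_projective D))"
proof (rule ring_iso_memI)
  let ?P = "linear_projective D :: (_, _, 'k, _) quiver_rep" and ?R = "projective_matrices D :: (_ \<Rightarrow> _ \<Rightarrow> 'k) ring"
  let ?B = "projective_basis D" and ?h = "matrix_hom D :: _ \<Rightarrow> _ \<Rightarrow> (_ \<Rightarrow> _ \<Rightarrow> 'k) \<Rightarrow> _" and ?E = "rep_end linear_quiver_3 ?P"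
  interpret P: quiver_representation linear_quiver_3 ?P
    by (rule quiver_representation_linear_projective)
  interpret R: ring ?R by (rule ring_block_triangular_ring) simp
  interpret E: ring ?E by (rule P.ring_rep_end)
  have car: "carrier ?E = rep_hom linear_quiver_3 ?P ?P" by (simp add: rep_end_def)
  have mem: "?h c \<in> carrier ?E" if "c \<in> carrier ?R" for c
    using matrix_hom_mem_rep_hom[OF that] car by simp
  then show "\<And>c. c \<in> carrier ?R \<Longrightarrow> ?h c \<in> carrier ?E" .
  have eqI: "\<phi> = \<psi>" if "\<phi> \<in> carrier ?E" "\<psi> \<in> carrier ?E"
    "\<And>v x b. v \<in> {1, 2, 3} \<Longrightarrow> x \<in> rep_space ?P v \<Longrightarrow> coord v (\<phi> v x) b = coord v (\<psi> v x) b" for \<phi> \<psi>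
  proof (rule rep_hom_eqI[OF that(1,2)[unfolded car]])
    fix v x assume "v \<in> verts linear_quiver_3" and x: "x \<in> rep_space ?P v"
    then have v: "v \<in> {1, 2, 3}" by simp
    show "\<phi> v x = \<psi> v x"
      by (rule coord_eqI[OF v _ _ that(3)[OF v x]])
        (use rep_hom_linear_projectiveD(1)[OF _ v x] that(1,2) car in auto)
  qed
  have val: "(\<phi> \<oplus>\<^bsub>?E\<^esub> \<psi>) v x = \<phi> v x + \<psi> v x" "(\<phi> \<otimes>\<^bsub>?E\<^esub> \<psi>) v x = \<phi> v (\<psi> v x)" "\<one>\<^bsub>?E\<^esub> v x = x"
    if "v \<in> {1, 2, 3}" "x \<in> rep_space ?P v" for \<phi> \<psi> v x
    using that by (auto simp: rep_end_def compose_def)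
  have valR: "(c \<oplus>\<^bsub>?R\<^esub> c') b e = c b e + c' b e" "(c \<otimes>\<^bsub>?R\<^esub> c') b e = (\<Sum>e'\<in>?B. c b e' * c' e' e)"
    "\<one>\<^bsub>?R\<^esub> b e = (if b \<in> ?B \<and> e = b then 1 else 0)" for c c' b e
    by (simp_all add: block_triangular_ring_def)
  show "?h (c \<otimes>\<^bsub>?R\<^esub> c') = ?h c \<otimes>\<^bsub>?E\<^esub> ?h c'" if c: "c \<in> carrier ?R" and c': "c' \<in> carrier ?R" for c c'
  proof (rule eqI)
    show "?h (c \<otimes>\<^bsub>?R\<^esub> c') \<in> carrier ?E" "?h c \<otimes>\<^bsub>?E\<^esub> ?h c' \<in> carrier ?E"
      using c c' mem by simp_all
    fix v x b assume v: "v \<in> {1, 2, 3}" and x: "x \<in> rep_space ?P v"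
    have "(\<Sum>e\<in>?B. (\<Sum>e'\<in>?B. c b e' * c' e' e) * coord v x e) = (\<Sum>e'\<in>?B. c b e' * (\<Sum>e\<in>?B. c' e' e * coord v x e))"
      unfolding sum_distrib_left sum_distrib_right by (subst sum.swap) (simp add: mult.assoc)
    then show "coord v (?h (c \<otimes>\<^bsub>?R\<^esub> c') v x) b = coord v ((?h c \<otimes>\<^bsub>?E\<^esub> ?h c') v x) b"
      unfolding val(2)[OF v x] coord_matrix_hom[OF R.m_closed[OF c c'] v x] valR(2)
        coord_matrix_hom[OF c v matrix_hom_mem[OF v x]] coord_matrix_hom[OF c' v x] .
  qed
  show "?h (c \<oplus>\<^bsub>?R\<^esub> c') = ?h c \<oplus>\<^bsub>?E\<^esub> ?h c'" if c: "c \<in> carrier ?R" and c': "c' \<in> carrier ?R" for c c'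
  proof (rule eqI)
    show "?h (c \<oplus>\<^bsub>?R\<^esub> c') \<in> carrier ?E" "?h c \<oplus>\<^bsub>?E\<^esub> ?h c' \<in> carrier ?E"
      using c c' mem by simp_all
    fix v x b assume v: "v \<in> {1, 2, 3}" and x: "x \<in> rep_space ?P v"
    show "coord v (?h (c \<oplus>\<^bsub>?R\<^esub> c') v x) b = coord v ((?h c \<oplus>\<^bsub>?E\<^esub> ?h c') v x) b"
      unfolding val(1)[OF v x] coord_add coord_matrix_hom[OF R.a_closed[OF c c'] v x] valR(1)
        coord_matrix_hom[OF c v x] coord_matrix_hom[OF c' v x] distrib_right sum.distrib ..
  qed
  show "?h \<one>\<^bsub>?R\<^esub> = \<one>\<^bsub>?E\<^esub>"
  proof (rule eqI)
    show "?h \<one>\<^bsub>?R\<^esub> \<in> carrier ?E" "\<one>\<^bsub>?E\<^esub> \<in> carrier ?E" using mem by simp_all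
    fix v x b assume v: "v \<in> {1, 2, 3}" and x: "x \<in> rep_space ?P v"
    have "(\<Sum>e\<in>?B. (if b \<in> ?B \<and> e = b then 1 else 0) * coord v x e) = (\<Sum>e\<in>?B. if e = b then coord v x e else 0)"
      by (rule sum.cong) auto
    also have "\<dots> = coord v x b" using coord_eq_0[OF v x, of b] by auto
    finally show "coord v (?h \<one>\<^bsub>?R\<^esub> v x) b = coord v (\<one>\<^bsub>?E\<^esub> v x) b"
      unfolding val(3)[OF v x] coord_matrix_hom[OF R.one_closed v x] valR(3) .
  qed
  show "bij_betw ?h (carrier ?R) (carrier ?E)"
    unfolding bij_betw_def using inj_on_matrix_hom matrix_hom_surj mem by (auto simp: car)
qed

section \<open>Counting commuting pairs\<close>

definition fun_scale :: "'k::field \<Rightarrow> (nat \<Rightarrow> 'k) \<Rightarrow> nat \<Rightarrow> 'k" where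
  "fun_scale c f = (\<lambda>r. c * f r)"

interpretation fun_scale: vector_space fun_scale
  by unfold_locales (auto simp: fun_scale_def fun_eq_iff algebra_simps)

text \<open>The space k^l as a subspace of one ambient space of functions, since a type cannot
  depend on \<open>l\<close>.\<close>

definition coord_space :: "nat \<Rightarrow> (nat \<Rightarrow> 'k::field) set" where
  "coord_space l = {f. \<forall>r\<ge>l. f r = 0}"

lemma subspace_coord_space: "fun_scale.subspace (coord_space l)"
  by (auto simp: fun_scale.subspace_def coord_space_def fun_scale_def)

lemma bij_betw_coord_space:
  "bij_betw (\<lambda>f. restrict f {..<l}) (coord_space l) ({..<l} \<rightarrow>\<^sub>E (UNIV :: 'k::field set))"
proof (rule bij_betw_byWitness[where f' = "\<lambda>f r. if r < l then f r else 0"])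
  show "\<forall>f\<in>{..<l} \<rightarrow>\<^sub>E UNIV. restrict (\<lambda>r. if r < l then f r else 0) {..<l} = f"
    by (auto simp: fun_eq_iff PiE_iff extensional_def)
  show "\<forall>f\<in>coord_space l. (\<lambda>r. if r < l then restrict f {..<l} r else 0) = (f :: nat \<Rightarrow> 'k)"
  proof (intro ballI ext)
    fix f :: "nat \<Rightarrow> 'k" and r assume "f \<in> coord_space l"
    then show "(if r < l then restrict f {..<l} r else 0) = f r" by (simp add: coord_space_def)
  qed
  show "(\<lambda>f. restrict f {..<l}) ` coord_space l \<subseteq> {..<l} \<rightarrow>\<^sub>E (UNIV :: 'k set)"
    unfolding image_subset_iff restrict_PiE_iff by blast
  show "(\<lambda>f r. if r < l then f r else 0) ` ({..<l} \<rightarrow>\<^sub>E (UNIV :: 'k set)) \<subseteq> coord_space l"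
    unfolding image_subset_iff coord_space_def by simp
qed

lemma finite_coord_space: "finite (coord_space l :: (nat \<Rightarrow> 'k::{field, finite}) set)"
  using bij_betw_finite[OF bij_betw_coord_space[where 'k = 'k]] by (simp add: finite_PiE)

lemma card_coord_space: "card (coord_space l :: (nat \<Rightarrow> 'k::{field, finite}) set) = CARD('k) ^ l"
  using bij_betw_same_card[OF bij_betw_coord_space[where 'k = 'k]] by (simp add: card_funcsetE)

lemma sum_fun_apply: "(\<Sum>a\<in>A. f a) r = (\<Sum>a\<in>A. f a r)"
  by (induction A rule: infinite_finite_induct) auto

section \<open>Strictly triangular matrices with three blocks\<close>

locale three_blocks =
  fixes l d m :: nat and B :: "(nat \<times> nat) set"
  assumes B: "B = {1} \<times> {..<l} \<union> {2} \<times> {..<d} \<union> {3} \<times> {..<m}"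
begin

lemma finite_B: "finite B"
  by (simp add: B)

definition strict_matrix :: "(nat \<Rightarrow> nat \<Rightarrow> 'k::field) \<Rightarrow> (nat \<Rightarrow> nat \<Rightarrow> 'k) \<Rightarrow> (nat \<Rightarrow> nat \<Rightarrow> 'k) \<Rightarrow> nat \<times> nat \<Rightarrow> nat \<times> nat \<Rightarrow> 'k" where
  "strict_matrix X Y Z b b' =
    (if b \<in> {1} \<times> {..<l} \<and> b' \<in> {2} \<times> {..<d} then X (snd b) (snd b')
     else if b \<in> {2} \<times> {..<d} \<and> b' \<in> {3} \<times> {..<m} then Y (snd b) (snd b')
     else if b \<in> {1} \<times> {..<l} \<and> b' \<in> {3} \<times> {..<m} then Z (snd b) (snd b') else 0)"

lemma strict_matrix_simps:
  "r < l \<Longrightarrow> s < d \<Longrightarrow> strict_matrix X Y Z (1, r) (2, s) = X r s"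
  "s < d \<Longrightarrow> t < m \<Longrightarrow> strict_matrix X Y Z (2, s) (3, t) = Y s t"
  "r < l \<Longrightarrow> t < m \<Longrightarrow> strict_matrix X Y Z (1, r) (3, t) = Z r t"
  by (simp_all add: strict_matrix_def)

lemma strict_matrix_cong:
  assumes "\<And>r s. r < l \<Longrightarrow> s < d \<Longrightarrow> X r s = X' r s" "\<And>s t. s < d \<Longrightarrow> t < m \<Longrightarrow> Y s t = Y' s t"
    "\<And>r t. r < l \<Longrightarrow> t < m \<Longrightarrow> Z r t = Z' r t"
  shows "strict_matrix X Y Z = strict_matrix X' Y' Z'"
proof (intro ext)
  fix b b'
  show "strict_matrix X Y Z b b' = strict_matrix X' Y' Z' b b'"
    unfolding strict_matrix_def using assms by (simp add: mem_Times_iff)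
qed

lemma strict_matrix_mem: "strict_matrix X Y Z \<in> strictly_block_triangular B fst"
  by (auto simp: strictly_block_triangular_def strict_matrix_def B split: if_splits)

text \<open>Levels lie in {1, 2, 3} and must increase strictly, so three blocks carry all nonzero
  entries.\<close>

lemma strict_matrix_entries:
  assumes x: "x \<in> strictly_block_triangular B fst"
  shows "strict_matrix (\<lambda>r s. x (1, r) (2, s)) (\<lambda>s t. x (2, s) (3, t)) (\<lambda>r t. x (1, r) (3, t)) = x"
proof (intro ext)
  fix b b'
  have "x b b' \<noteq> 0 \<Longrightarrow> b \<in> B \<and> b' \<in> B \<and> fst b < fst b'"
    using x unfolding strictly_block_triangular_def by blast
  then show "strict_matrix (\<lambda>r s. x (1, r) (2, s)) (\<lambda>s t. x (2, s) (3, t)) (\<lambda>r t. x (1, r) (3, t)) b b' = x b b'"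
    by (cases b; cases b'; cases "x b b' = 0") (auto simp: strict_matrix_def B)
qed

text \<open>In a nonzero term the level rises twice, so the middle index lies in block 2 and the
  product lives in the corner block.\<close>

lemma mult_strict_matrix:
  "strict_matrix X Y Z \<otimes>\<^bsub>block_triangular_ring B fst\<^esub> strict_matrix X' Y' Z' =
    strict_matrix (\<lambda>r s. 0) (\<lambda>s t. 0) (\<lambda>r t. \<Sum>s<d. X r s * Y' s t)"
proof (intro ext)
  fix b b'
  let ?x = "strict_matrix X Y Z" and ?y = "strict_matrix X' Y' Z'"
  have "(\<Sum>e\<in>B. ?x b e * ?y e b') = (\<Sum>e\<in>{2} \<times> {..<d}. ?x b e * ?y e b')"
  proof (rule sum.mono_neutral_right[OF finite_B])
    show "\<forall>e\<in>B - {2} \<times> {..<d}. ?x b e * ?y e b' = 0"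
      by (auto simp: B strict_matrix_def)
  qed (auto simp: B)
  also have "\<dots> = (\<Sum>s<d. ?x b (2, s) * ?y (2, s) b')"
    by (simp add: sum.cartesian_product')
  also have "\<dots> = strict_matrix (\<lambda>r s. 0) (\<lambda>s t. 0) (\<lambda>r t. \<Sum>s<d. X r s * Y' s t) b b'"
  proof (cases "b \<in> {1} \<times> {..<l} \<and> b' \<in> {3} \<times> {..<m}")
    case True
    then show ?thesis by (auto simp: strict_matrix_def intro!: sum.cong)
  next
    case False
    then have "?x b (2, s) * ?y (2, s) b' = 0" for s by (auto simp: strict_matrix_def)
    then have "(\<Sum>s<d. ?x b (2, s) * ?y (2, s) b') = 0" by (intro sum.neutral ballI)
    moreover have "strict_matrix (\<lambda>r s. 0) (\<lambda>s t. 0) (\<lambda>r t. \<Sum>s<d. X r s * Y' s t) b b' = 0"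
      using False by (auto simp: strict_matrix_def)
    ultimately show ?thesis by (simp only:)
  qed
  finally show "(?x \<otimes>\<^bsub>block_triangular_ring B fst\<^esub> ?y) b b' =
      strict_matrix (\<lambda>r s. 0) (\<lambda>s t. 0) (\<lambda>r t. \<Sum>s<d. X r s * Y' s t) b b'"
    by (simp add: block_triangular_ring_def)
qed

lemma commute_strict_matrix_iff:
  "strict_matrix X Y Z \<otimes>\<^bsub>block_triangular_ring B fst\<^esub> strict_matrix X' Y' Z' =
    strict_matrix X' Y' Z' \<otimes>\<^bsub>block_triangular_ring B fst\<^esub> strict_matrix X Y Z \<longleftrightarrow>
    (\<forall>r<l. \<forall>t<m. (\<Sum>s<d. X r s * Y' s t) = (\<Sum>s<d. X' r s * Y s t))" (is "?L \<longleftrightarrow> ?R")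
proof
  assume eq: ?L
  show ?R
  proof (intro allI impI)
    fix r t assume rt: "r < l" "t < m"
    show "(\<Sum>s<d. X r s * Y' s t) = (\<Sum>s<d. X' r s * Y s t)"
      using fun_cong[OF fun_cong[OF eq], of "(1, r)" "(3, t)"] rt
      unfolding mult_strict_matrix by (simp only: strict_matrix_simps)
  qed
next
  assume ?R
  then show ?L unfolding mult_strict_matrix by (intro strict_matrix_cong) auto
qed

section \<open>Commuting pairs as families of vectors with relations\<close>

definition pair_index :: "(bool \<times> nat) set" where
  "pair_index = UNIV \<times> {..<d}"

lemma sum_pair_index: "(\<Sum>u\<in>pair_index. f u) = (\<Sum>s<d. f (True, s)) + (\<Sum>s<d. f (False, s))"
  unfolding pair_index_def sum.cartesian_product' UNIV_bool by (simp add: add.commute)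

text \<open>The left factors \<open>X, - X'\<close> form a family \<open>w\<close> of \<open>2 d\<close> vectors; the pair commutes iff every column of
  the stacked matrix of \<open>Y'\<close> and \<open>Y\<close> is a linear relation of \<open>w\<close>.\<close>

definition pair_data :: "((bool \<times> nat \<times> nat \<Rightarrow> 'k::field) \<times> (bool \<times> nat \<Rightarrow> nat \<Rightarrow> 'k) \<times> (nat \<Rightarrow> bool \<times> nat \<Rightarrow> 'k)) set" where
  "pair_data = (UNIV \<times> {..<l} \<times> {..<m} \<rightarrow>\<^sub>E UNIV) \<times>
    (SIGMA w:pair_index \<rightarrow>\<^sub>E coord_space l. {..<m} \<rightarrow>\<^sub>E family_kernel fun_scale pair_index w)"

text \<open>In \<open>w\<close> and \<open>n\<close> the Boolean tells which of the products X Y'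
  and X' Y is meant. The coefficient of a column of X is an entry of Y', so relations enter the two
  matrices crosswise. In \<open>z\<close> it tells the two matrices apart.\<close>

definition pair_of_data where
  "pair_of_data = (\<lambda>(z, w, n).
    (strict_matrix (\<lambda>r s. w (True, s) r) (\<lambda>s t. n t (False, s)) (\<lambda>r t. z (True, r, t)),
     strict_matrix (\<lambda>r s. - w (False, s) r) (\<lambda>s t. n t (True, s)) (\<lambda>r t. z (False, r, t))))"

definition data_of_pair where
  "data_of_pair = (\<lambda>(x, y).
    (\<lambda>u\<in>UNIV \<times> {..<l} \<times> {..<m}. (if fst u then x else y) (1, fst (snd u)) (3, snd (snd u)),
     \<lambda>u\<in>pair_index. \<lambda>r. if r < l then if fst u then x (1, r) (2, snd u) else - y (1, r) (2, snd u) else 0,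
     \<lambda>t\<in>{..<m}. \<lambda>u\<in>pair_index. (if fst u then y else x) (2, snd u) (3, t)))"

lemma mem_family_kernel_pair_index:
  "c \<in> family_kernel fun_scale pair_index w \<longleftrightarrow> c \<in> pair_index \<rightarrow>\<^sub>E UNIV \<and>
    (\<forall>r. (\<Sum>s<d. w (True, s) r * c (True, s)) + (\<Sum>s<d. w (False, s) r * c (False, s)) = 0)"
  by (simp add: family_kernel_def fun_eq_iff sum_fun_apply fun_scale_def sum_pair_index mult.commute)

lemma pair_of_data_mem:
  assumes "u \<in> pair_data"
  shows "pair_of_data u \<in> commuting_pairs (strictly_block_triangular B fst) (block_triangular_ring B fst)"
proof -
  obtain z w n where u: "u = (z, w, n)" by (cases u)
  have "(\<Sum>s<d. w (True, s) r * n t (True, s)) = (\<Sum>s<d. - w (False, s) r * n t (False, s))" if "t < m" for r t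
  proof -
    have "n t \<in> family_kernel fun_scale pair_index w"
      using assms that by (auto simp: u pair_data_def)
    then have "(\<Sum>s<d. w (True, s) r * n t (True, s)) + (\<Sum>s<d. w (False, s) r * n t (False, s)) = 0"
      unfolding mem_family_kernel_pair_index by blast
    then show ?thesis by (simp add: sum_negf eq_neg_iff_add_eq_0)
  qed
  then show ?thesis
    unfolding commuting_pairs_def pair_of_data_def u case_prod_conv mem_Collect_eq commute_strict_matrix_iff
    by (simp add: strict_matrix_mem)
qed

lemma data_of_pair_mem:
  assumes "p \<in> commuting_pairs (strictly_block_triangular B fst) (block_triangular_ring B fst)"
  shows "data_of_pair p \<in> pair_data"
proof -
  obtain x y where p: "p = (x, y)" by (cases p)
  have xy: "x \<in> strictly_block_triangular B fst" "y \<in> strictly_block_triangular B fst"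
    "x \<otimes>\<^bsub>block_triangular_ring B fst\<^esub> y = y \<otimes>\<^bsub>block_triangular_ring B fst\<^esub> x"
    using assms by (auto simp: p commuting_pairs_def)
  \<comment> \<open>Both matrices are rewritten through their blocks, to which the commutation
    criterion applies.\<close>
  have comm: "(\<Sum>s<d. x (1, r) (2, s) * y (2, s) (3, t)) = (\<Sum>s<d. y (1, r) (2, s) * x (2, s) (3, t))"
    if "r < l" "t < m" for r t
    using xy(3) that
    by (subst (asm) (1 2) strict_matrix_entries[OF xy(1), symmetric],
        subst (asm) (1 2) strict_matrix_entries[OF xy(2), symmetric])
      (simp only: commute_strict_matrix_iff)
  let ?w = "\<lambda>u\<in>pair_index. \<lambda>r. if r < l then if fst u then x (1, r) (2, snd u) else - y (1, r) (2, snd u) else 0"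
  have "(\<lambda>u\<in>pair_index. (if fst u then y else x) (2, snd u) (3, t)) \<in> family_kernel fun_scale pair_index ?w"
    if t: "t < m" for t
    unfolding mem_family_kernel_pair_index
  proof (intro conjI allI)
    fix r
    show "(\<Sum>s<d. ?w (True, s) r * (\<lambda>u\<in>pair_index. (if fst u then y else x) (2, snd u) (3, t)) (True, s)) +
      (\<Sum>s<d. ?w (False, s) r * (\<lambda>u\<in>pair_index. (if fst u then y else x) (2, snd u) (3, t)) (False, s)) = 0"
    \<comment> \<open>From coordinate \<open>l\<close> on, all vectors of the family are 0; only r <
      l carries the commutation condition.\<close>
    proof (cases "r < l")
      case True
      then show ?thesis using comm[OF True t] by (simp add: pair_index_def sum_negf)
    next
      case False
      then show ?thesis by (simp add: pair_index_def)
    qed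
  qed simp
  moreover have "?w \<in> pair_index \<rightarrow>\<^sub>E coord_space l"
    by (auto simp: coord_space_def)
  ultimately show ?thesis
    unfolding pair_data_def data_of_pair_def p case_prod_conv by (intro SigmaI) auto
qed

lemma pair_of_data_of_pair:
  assumes "p \<in> commuting_pairs (strictly_block_triangular B fst) (block_triangular_ring B fst)"
  shows "pair_of_data (data_of_pair p) = p"
proof -
  obtain x y where p: "p = (x, y)" by (cases p)
  have xy: "x \<in> strictly_block_triangular B fst" "y \<in> strictly_block_triangular B fst"
    using assms by (auto simp: p commuting_pairs_def)
  obtain z w n where zwn: "data_of_pair p = (z, w, n)" by (cases "data_of_pair p")
  then have *: "z = (\<lambda>u\<in>UNIV \<times> {..<l} \<times> {..<m}. (if fst u then x else y) (1, fst (snd u)) (3, snd (snd u)))"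
    "w = (\<lambda>u\<in>pair_index. \<lambda>r. if r < l then if fst u then x (1, r) (2, snd u) else - y (1, r) (2, snd u) else 0)"
    "n = (\<lambda>t\<in>{..<m}. \<lambda>u\<in>pair_index. (if fst u then y else x) (2, snd u) (3, t))"
    by (simp_all add: p data_of_pair_def)
  have "strict_matrix (\<lambda>r s. w (True, s) r) (\<lambda>s t. n t (False, s)) (\<lambda>r t. z (True, r, t)) = x"
    by (subst strict_matrix_entries[OF xy(1), symmetric], rule strict_matrix_cong) (simp_all add: * pair_index_def)
  moreover have "strict_matrix (\<lambda>r s. - w (False, s) r) (\<lambda>s t. n t (True, s)) (\<lambda>r t. z (False, r, t)) = y"
    by (subst strict_matrix_entries[OF xy(2), symmetric], rule strict_matrix_cong) (simp_all add: * pair_index_def)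
  ultimately show ?thesis unfolding zwn pair_of_data_def unfolding p by simp
qed

text \<open>The data are \<open>undefined\<close> off their index sets, whereas
  \<open>strict_matrix\<close> reads only values inside. The case splits check that
  \<open>data_of_pair\<close> restores these defaults, and the zeros of \<open>w\<close> from
  coordinate \<open>l\<close> on.\<close>

lemma data_of_pair_of_data:
  assumes "u \<in> pair_data"
  shows "data_of_pair (pair_of_data u) = u"
proof -
  obtain z w n where u: "u = (z, w, n)" by (cases u)
  have z: "z \<in> UNIV \<times> {..<l} \<times> {..<m} \<rightarrow>\<^sub>E UNIV" and w: "w \<in> pair_index \<rightarrow>\<^sub>E coord_space l"
    and n: "n \<in> {..<m} \<rightarrow>\<^sub>E family_kernel fun_scale pair_index w"
    using assms by (auto simp: u pair_data_def)
  have z0: "z (p, r, t) = undefined" if "\<not> (r < l \<and> t < m)" for p r t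
    using PiE_arb[OF z, of "(p, r, t)"] that by auto
  have w0: "w (p, s) = undefined" if "\<not> s < d" for p s
    using PiE_arb[OF w, of "(p, s)"] that by (auto simp: pair_index_def)
  have wl: "w (p, s) r = 0" if "s < d" "\<not> r < l" for p s r
    using PiE_mem[OF w, of "(p, s)"] that by (auto simp: pair_index_def coord_space_def)
  have n0: "n t = undefined" if "\<not> t < m" for t
    using PiE_arb[OF n, of t] that by auto
  have nt: "n t \<in> pair_index \<rightarrow>\<^sub>E UNIV" if "t < m" for t
    using PiE_mem[OF n, of t] that by (simp add: family_kernel_def)
  have nt0: "n t (p, s) = undefined" if "t < m" "\<not> s < d" for t p s
    using PiE_arb[OF nt[OF that(1)], of "(p, s)"] that by (auto simp: pair_index_def)
  obtain z' w' n' where zwn: "data_of_pair (pair_of_data u) = (z', w', n')" by (cases "data_of_pair (pair_of_data u)")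
  define x where "x = strict_matrix (\<lambda>r s. w (True, s) r) (\<lambda>s t. n t (False, s)) (\<lambda>r t. z (True, r, t))"
  define y where "y = strict_matrix (\<lambda>r s. - w (False, s) r) (\<lambda>s t. n t (True, s)) (\<lambda>r t. z (False, r, t))"
  have "pair_of_data u = (x, y)" by (simp add: pair_of_data_def u x_def y_def)
  then have *: "z' = (\<lambda>u\<in>UNIV \<times> {..<l} \<times> {..<m}. (if fst u then x else y) (1, fst (snd u)) (3, snd (snd u)))"
    "w' = (\<lambda>u\<in>pair_index. \<lambda>r. if r < l then if fst u then x (1, r) (2, snd u) else - y (1, r) (2, snd u) else 0)"
    "n' = (\<lambda>t\<in>{..<m}. \<lambda>u\<in>pair_index. (if fst u then y else x) (2, snd u) (3, t))"
    using zwn by (simp_all add: data_of_pair_def)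
  note vals = strict_matrix_simps[of _ _ "\<lambda>r s. w (True, s) r" "\<lambda>s t. n t (False, s)" "\<lambda>r t. z (True, r, t)", folded x_def]
    strict_matrix_simps[of _ _ "\<lambda>r s. - w (False, s) r" "\<lambda>s t. n t (True, s)" "\<lambda>r t. z (False, r, t)", folded y_def]
  have "z' (p, r, t) = z (p, r, t)" for p r t
    by (cases "r < l \<and> t < m"; cases p) (auto simp: * vals z0 simp del: One_nat_def)
  moreover have "w' (p, s) r = w (p, s) r" for p s r
    by (cases "s < d"; cases "r < l"; cases p) (auto simp: * pair_index_def vals w0 wl simp del: One_nat_def)
  moreover have "n' t (p, s) = n t (p, s)" for t p s
    by (cases "t < m"; cases "s < d"; cases p) (auto simp: * pair_index_def vals n0 nt0 simp del: One_nat_def)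
  ultimately show ?thesis unfolding zwn unfolding u by (simp add: fun_eq_iff)
qed

text \<open>In \<open>pair_data\<close> the set of relations depends on the family; the cardinality
  of this dependent sum is what becomes a sum over families.\<close>

lemma card_commuting_pairs_strictly_block_triangular:
  defines "q \<equiv> real CARD('k)"
  shows "real (card (commuting_pairs (strictly_block_triangular B fst)
      (block_triangular_ring B fst :: (_ \<Rightarrow> _ \<Rightarrow> 'k::{field, finite}) ring))) =
    q ^ (2 * l * m) * (\<Sum>i\<le>2 * d. q ^ (m * i) * gauss_binomial q (2 * d) i * (\<Prod>j<2 * d - i. q ^ l - q ^ j))"
proof -
  let ?W = "pair_index \<rightarrow>\<^sub>E (coord_space l :: (nat \<Rightarrow> 'k) set)"
  have fin: "finite pair_index" and card: "card pair_index = 2 * d"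
    by (simp_all add: pair_index_def card_cartesian_product card_UNIV_bool)
  have "bij_betw (pair_of_data :: _ \<Rightarrow> (_ \<Rightarrow> _ \<Rightarrow> 'k) \<times> _) pair_data
      (commuting_pairs (strictly_block_triangular B fst) (block_triangular_ring B fst))"
    by (rule bij_betw_byWitness[where f' = data_of_pair])
      (auto simp: data_of_pair_of_data pair_of_data_of_pair pair_of_data_mem data_of_pair_mem)
  then have "card (commuting_pairs (strictly_block_triangular B fst)
      (block_triangular_ring B fst :: (_ \<Rightarrow> _ \<Rightarrow> 'k) ring)) = card (pair_data :: ((_ \<Rightarrow> 'k) \<times> _) set)"
    by (simp add: bij_betw_same_card)
  also have "\<dots> = CARD('k) ^ (2 * l * m) * (\<Sum>w\<in>?W. card (family_kernel fun_scale pair_index w) ^ m)"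
  proof -
    have "finite (family_kernel fun_scale pair_index (w :: _ \<Rightarrow> _ \<Rightarrow> 'k))" for w
      by (rule finite_subset[of _ "pair_index \<rightarrow>\<^sub>E UNIV"]) (auto simp: family_kernel_def finite_PiE fin)
    moreover have "finite ?W" by (intro finite_PiE fin finite_coord_space)
    ultimately have "card (SIGMA w:?W. {..<m} \<rightarrow>\<^sub>E family_kernel fun_scale pair_index w) =
        (\<Sum>w\<in>?W. card (family_kernel fun_scale pair_index w) ^ m)"
      by (subst card_SigmaI) (simp_all add: finite_PiE card_funcsetE)
    moreover have "card ((UNIV :: bool set) \<times> {..<l} \<times> {..<m} \<rightarrow>\<^sub>E (UNIV :: 'k set)) = CARD('k) ^ (2 * l * m)"
      by (simp add: card_funcsetE card_cartesian_product card_UNIV_bool mult.assoc)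
    ultimately show ?thesis by (simp add: pair_data_def card_cartesian_product)
  qed
  finally have "real (card (commuting_pairs (strictly_block_triangular B fst)
      (block_triangular_ring B fst :: (_ \<Rightarrow> _ \<Rightarrow> 'k) ring))) =
    q ^ (2 * l * m) * (\<Sum>w\<in>?W. real (card (family_kernel fun_scale pair_index w)) ^ m)"
    by (simp add: q_def)
  \<comment> \<open>The summation formula with g(k) = k^m; a kernel of size q^i yields q^(m
    i).\<close>
  also have "(\<Sum>w\<in>?W. real (card (family_kernel fun_scale pair_index w)) ^ m) =
      (\<Sum>i\<le>2 * d. q ^ (m * i) * gauss_binomial q (2 * d) i * (\<Prod>j<2 * d - i. q ^ l - q ^ j))"
    unfolding fun_scale.sum_card_family_kernel[OF finite fin subspace_coord_space finite_coord_space card_coord_space,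
        of "\<lambda>k. real k ^ m"] card q_def
    by (simp add: power_mult[symmetric] mult.commute[of m])
  finally show ?thesis .
qed

end

theorem proposition4p1:
  fixes K :: "'k::{field, finite} itself" and l d m q :: nat
  assumes "q = CARD('k)"
    and "l \<ge> 1" and "d \<ge> 1" and "m \<ge> 1"
  shows "real (commuting_radical_pairs K linear_quiver_3 ((\<lambda>_. 0)(1 := l, 2 := d, 3 := m))) =
    real q ^ (2 * l * m) *
    (\<Sum>i = nat (max 0 (2 * int d - int l))..2 * d.
       real q ^ (m * i) *
       (\<Prod>j<i. (real q ^ (2 * d) - real q ^ j) / (real q ^ i - real q ^ j)) *
       (\<Prod>j<2 * d - i. real q ^ l - real q ^ j))"
proof -
  define D :: "nat \<Rightarrow> nat" where "D = (\<lambda>_. 0)(1 := l, 2 := d, 3 := m)"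
  let ?B = "projective_basis D"
  let ?R = "projective_matrices D :: (_ \<Rightarrow> _ \<Rightarrow> 'k) ring"
  let ?E = "rep_end linear_quiver_3 (linear_projective D :: (_, _, 'k, _) quiver_rep)"
  let ?f = "\<lambda>i. real q ^ (m * i) * gauss_binomial (real q) (2 * d) i * (\<Prod>j<2 * d - i. real q ^ l - real q ^ j)"
  have R: "ring ?R" by (rule ring_block_triangular_ring) simp
  have E: "ring ?E" by (rule quiver_representation.ring_rep_end[OF quiver_representation_linear_projective])
  interpret three_blocks l d m ?B
    by unfold_locales (auto simp: projective_basis_def D_def)
  have rad: "jacobson_radical ?R = strictly_block_triangular ?B fst"
    by (rule jacobson_radical_block_triangular_ring) simp
  have "commuting_radical_pairs K linear_quiver_3 D = card (commuting_pairs (jacobson_radical ?E) ?E)"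
    by (simp add: commuting_radical_pairs_def commuting_pairs_def Let_def)
  \<comment> \<open>The isomorphism carries the radical and the relation of commuting at the same
    time, which moves the count to matrices.\<close>
  also have "\<dots> = card (commuting_pairs (jacobson_radical ?R) ?R)"
    unfolding ring_iso_image_jacobson_radical[OF R E matrix_hom_ring_iso, symmetric]
    by (rule ring_iso_card_commuting_pairs[OF R matrix_hom_ring_iso]) (auto simp: jacobson_radical_def)
  finally have "real (commuting_radical_pairs K linear_quiver_3 D) = real q ^ (2 * l * m) * (\<Sum>i\<le>2 * d. ?f i)"
    using card_commuting_pairs_strictly_block_triangular[where 'k = 'k]
    by (simp only: rad assms(1))
  \<comment> \<open>A family in k^l cannot have rank 2d - i > l: for such \<open>i\<close> the last
    product contains the factor with j = l, which is 0.\<close>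
  also have "(\<Sum>i\<le>2 * d. ?f i) = (\<Sum>i = nat (max 0 (2 * int d - int l))..2 * d. ?f i)"
  proof (rule sum.mono_neutral_right)
    show "\<forall>i\<in>{..2 * d} - {nat (max 0 (2 * int d - int l))..2 * d}. ?f i = 0"
    proof
      fix i assume "i \<in> {..2 * d} - {nat (max 0 (2 * int d - int l))..2 * d}"
      then have "l < 2 * d - i" by auto
      then have "(\<Prod>j<2 * d - i. real q ^ l - real q ^ j) = 0" by auto
      then show "?f i = 0" by simp
    qed
  qed auto
  finally show ?thesis unfolding D_def gauss_binomial_def .
qed

end
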